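(* Let $m\ge1$. The poset $(\mathcal{W}(B_{2m}),\leqslant)$ is graded, with rank function $\ell_{\mathcal{W}}$, and its rank is $3m^2$.
   Context: For $k\ge1$, $B_k$ is the group of bijections $w$ of $[\pm k]=\{-k,\dots,-1,1,\dots,k\}$ with $w(-a)=-w(a)$, in window notation $[w(1),\dots,w(k)]$; it is a Coxeter group with generators $(1,-1)$ and $(a,a+1)(-a,-a-1)$, $a\in[k-1]$; length $\ell_B(w)=\mathrm{inv}(w)+\mathrm{neg}(w)+\mathrm{nsp}(w)$ with $\mathrm{inv}(w)=|\{(a,b):1\le a<b\le k,\ w(a)>w(b)\}|$, $\mathrm{neg}(w)=|\{a\in[k]:w(a)<0\}|$, $\mathrm{nsp}(w)=|\{(a,b):1\le a<b\le k,\ w(a)+w(b)<0\}|$; $\leqslant$ is Bruhat order. For $a\in[n]$ let $a^*=a-1$ if $a$ even, $a^*=a+1$ if $a$ odd and $a+1\le n$, $a^*=n$ otherwise; $\mathcal{W}(B_n)=\{v\in B_n: |v^{-1}(a)-v^{-1}(a^* )|\le1\ \forall a\in[n-1]\}$ with the induced Bruhat order. Let $\chi(P)=1$ if $P$ holds, $0$ otherwise. Given $\sigma\in B_m$, $T\subseteq[m]$, define $v\in B_{2m}$ by $v(2i-1)=2\sigma(i)-\chi(\sigma(i)>0)$, $v(2i)=2\sigma(i)+\chi(\sigma(i)<0)$ if $i\notin T$, and $v(2i-1)=2\sigma(i)+\chi(\sigma(i)<0)$, $v(2i)=2\sigma(i)-\chi(\sigma(i)>0)$ if $i\in T$; this is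 a bijection $B_m\times\mathcal{P}([m])\to\mathcal{W}(B_{2m})$, and we write $v=(\sigma,T)$ and $\ell_{\mathcal{W}}(v)=\ell_B(v)-\ell_B(\sigma)$. *)

theory Defs
  imports "HOL-Combinatorics.Permutations"
begin

definition signed_interval :: "nat \<Rightarrow> int set" where
  "signed_interval k = {- int k..int k} - {0}"

text \<open>
  Elements of \<open>B\<^sub>k\<close> are functions on all of \<open>int\<close> that are the identity outside
  \<open>[\<plusminus>k]\<close> (part of \<open>permutes\<close>), so that equality of functions is equality in \<open>B\<^sub>k\<close>
  and the group operation is composition.
\<close>
definition B :: "nat \<Rightarrow> (int \<Rightarrow> int) set" where
  "B k = {w. w permutes signed_interval k \<and> (\<forall>a\<in>signed_interval k. w (- a) = - w a)}"

definition gens_B :: "nat \<Rightarrow> (int \<Rightarrow> int) set" where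
  "gens_B k = {transpose 1 (- 1)} \<union>
     {transpose a (a + 1) \<circ> transpose (- a) (- a - 1) | a. a \<in> {1..int k - 1}}"

definition reflections_B :: "nat \<Rightarrow> (int \<Rightarrow> int) set" where
  "reflections_B k = {w \<circ> s \<circ> inv w | w s. w \<in> B k \<and> s \<in> gens_B k}"

definition inv_B :: "nat \<Rightarrow> (int \<Rightarrow> int) \<Rightarrow> nat" where
  "inv_B k w = card {(a, b). 1 \<le> a \<and> a < b \<and> b \<le> int k \<and> w a > w b}"

definition neg_B :: "nat \<Rightarrow> (int \<Rightarrow> int) \<Rightarrow> nat" where
  "neg_B k w = card {a \<in> {1..int k}. w a < 0}"

definition nsp_B :: "nat \<Rightarrow> (int \<Rightarrow> int) \<Rightarrow> nat" where
  "nsp_B k w = card {(a, b). 1 \<le> a \<and> a < b \<and> b \<le> int k \<and> w a + w b < 0}"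

definition length_B :: "nat \<Rightarrow> (int \<Rightarrow> int) \<Rightarrow> nat" where
  "length_B k w = inv_B k w + neg_B k w + nsp_B k w"

definition bruhat_step :: "nat \<Rightarrow> (int \<Rightarrow> int) \<Rightarrow> (int \<Rightarrow> int) \<Rightarrow> bool" where
  "bruhat_step k u w \<longleftrightarrow>
     u \<in> B k \<and> (\<exists>t\<in>reflections_B k. w = u \<circ> t) \<and> length_B k u < length_B k w"

definition bruhat_le :: "nat \<Rightarrow> (int \<Rightarrow> int) \<Rightarrow> (int \<Rightarrow> int) \<Rightarrow> bool" where
  "bruhat_le k = (bruhat_step k)\<^sup>*\<^sup>*"

definition star :: "nat \<Rightarrow> int \<Rightarrow> int" where
  "star n a = (if even a then a - 1 else if a + 1 \<le> int n then a + 1 else int n)"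

definition W_B :: "nat \<Rightarrow> (int \<Rightarrow> int) set" where
  "W_B n = {v \<in> B n. \<forall>a\<in>{1..int n - 1}. \<bar>inv v a - inv v (star n a)\<bar> \<le> 1}"

text \<open>The intermediate elements of a Bruhat chain range over all of \<open>B\<^sub>n\<close>.\<close>
definition W_order :: "nat \<Rightarrow> ((int \<Rightarrow> int) \<times> (int \<Rightarrow> int)) set" where
  "W_order n = {(u, v). u \<in> W_B n \<and> v \<in> W_B n \<and> bruhat_le n u v}"

text \<open>\<open>represents m v \<sigma> T\<close> is the relation \<open>v = (\<sigma>, T)\<close>.\<close>
definition represents :: "nat \<Rightarrow> (int \<Rightarrow> int) \<Rightarrow> (int \<Rightarrow> int) \<Rightarrow> int set \<Rightarrow> bool" where
  "represents m v \<sigma> T \<longleftrightarrow>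
     v \<in> B (2 * m) \<and> \<sigma> \<in> B m \<and> T \<subseteq> {1..int m} \<and>
     (\<forall>i\<in>{1..int m}.
        (i \<notin> T \<longrightarrow> v (2 * i - 1) = 2 * \<sigma> i - of_bool (\<sigma> i > 0) \<and>
                   v (2 * i) = 2 * \<sigma> i + of_bool (\<sigma> i < 0)) \<and>
        (i \<in> T \<longrightarrow> v (2 * i - 1) = 2 * \<sigma> i + of_bool (\<sigma> i < 0) \<and>
                   v (2 * i) = 2 * \<sigma> i - of_bool (\<sigma> i > 0)))"

definition sigma_part :: "nat \<Rightarrow> (int \<Rightarrow> int) \<Rightarrow> (int \<Rightarrow> int)" where
  "sigma_part m v = (THE \<sigma>. \<exists>T. represents m v \<sigma> T)"

text \<open>Integer-valued, to avoid truncated subtraction.\<close>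
definition length_W :: "nat \<Rightarrow> (int \<Rightarrow> int) \<Rightarrow> int" where
  "length_W m v = int (length_B (2 * m) v) - int (length_B m (sigma_part m v))"

text \<open>
  A poset is graded of rank \<open>n\<close> if all its maximal chains have length \<open>n\<close>, that is,
  \<open>n + 1\<close> elements; the finiteness of the chains is implied, as infinite sets have
  cardinality 0.
\<close>
definition graded_poset_of_rank :: "'a set \<Rightarrow> ('a \<times> 'a) set \<Rightarrow> nat \<Rightarrow> bool" where
  "graded_poset_of_rank A r n \<longleftrightarrow>
     partial_order_on A r \<and>
     (\<forall>C. pred_on.maxchain A (\<lambda>x y. (x, y) \<in> r) C \<longrightarrow> card C = n + 1)"

definition minimal_in :: "'a set \<Rightarrow> ('a \<times> 'a) set \<Rightarrow> 'a \<Rightarrow> bool" where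
  "minimal_in A r x \<longleftrightarrow> x \<in> A \<and> (\<forall>y\<in>A. (y, x) \<in> r \<longrightarrow> y = x)"

definition covered_by :: "'a set \<Rightarrow> ('a \<times> 'a) set \<Rightarrow> 'a \<Rightarrow> 'a \<Rightarrow> bool" where
  "covered_by A r x y \<longleftrightarrow>
     x \<in> A \<and> y \<in> A \<and> (x, y) \<in> r \<and> x \<noteq> y \<and>
     (\<forall>z\<in>A. (x, z) \<in> r \<and> (z, y) \<in> r \<longrightarrow> z = x \<or> z = y)"

definition rank_function :: "'a set \<Rightarrow> ('a \<times> 'a) set \<Rightarrow> ('a \<Rightarrow> int) \<Rightarrow> bool" where
  "rank_function A r \<rho> \<longleftrightarrow>
     (\<forall>x. minimal_in A r x \<longrightarrow> \<rho> x = 0) \<and>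
     (\<forall>x y. covered_by A r x y \<longrightarrow> \<rho> y = \<rho> x + 1)"

end

theory Submission
  imports Defs
begin

text \<open>
  Bruhat order on \<open>B\<^sub>k\<close> is comparison of the rank functions
  \<open>rk w p q = #{c \<le> p. w c \<ge> q}\<close> over \<open>[\<plusminus>k]\<close>: if \<open>rk u \<le> rk v\<close> and \<open>u \<noteq> v\<close>, then there is a
  rectangle spanned by two points of the graph of \<open>u\<close>, empty of other points, on which the
  inequality is strict, and it can be chosen either invariant under or disjoint from its point
  reflection, so that the corresponding reflection is a cover of \<open>u\<close> still below \<open>v\<close>.

  For \<open>u = (\<sigma>, T)\<close> and \<open>v = (\<tau>, S)\<close>, interpolating ranks inside \<open>2 \<times> 2\<close> blocks shows that
  \<open>u \<le> v\<close> iff \<open>\<sigma> \<le> \<tau>\<close> and every \<open>i \<in> T\<close> such that \<open>rk \<sigma>\<close> and \<open>rk \<tau>\<close> agree at the four corners of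
  the block \<open>(i, \<sigma> i)\<close> lies in \<open>S\<close>. If \<open>u < v\<close>, either some \<open>i\<close> can be added to \<open>T\<close>, or all
  \<open>i \<notin> T\<close> are frozen. In the latter case a cover \<open>\<sigma> t\<close> of \<open>\<sigma>\<close> below \<open>\<tau>\<close> moves only elements of \<open>T\<close>, and
  deleting those from \<open>T\<close> gives an element between \<open>u\<close> and \<open>v\<close>. Both moves raise
  \<open>length_W = (3 invs \<sigma> + neg \<sigma>) / 2 + |T|\<close>, with \<open>invs\<close> counted on \<open>[\<plusminus>m]\<close>, by exactly one.
\<close>

section \<open>Rank functions of permutations\<close>

definition rk :: "int set \<Rightarrow> (int \<Rightarrow> int) \<Rightarrow> int \<Rightarrow> int \<Rightarrow> int" where
  "rk S w p q = (\<Sum>c\<in>S. of_bool (c \<le> p \<and> q \<le> w c))"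

definition invs :: "int set \<Rightarrow> (int \<Rightarrow> int) \<Rightarrow> int" where
  "invs S w = (\<Sum>a\<in>S. \<Sum>b\<in>S. of_bool (a < b \<and> w b < w a))"

definition empty_rect :: "int set \<Rightarrow> (int \<Rightarrow> int) \<Rightarrow> int \<Rightarrow> int \<Rightarrow> bool" where
  "empty_rect S w i j \<longleftrightarrow> (\<forall>c\<in>S. \<not> (i < c \<and> c < j \<and> w i < w c \<and> w c < w j))"

lemma sum_remove2:
  fixes f :: "'a \<Rightarrow> 'b::comm_monoid_add"
  assumes "finite S" "i \<in> S" "j \<in> S" "i \<noteq> j"
  shows "sum f S = f i + f j + sum f (S - {i, j})"
proof -
  have "sum f S = f i + sum f (S - {i})" using assms by (simp add: sum.remove)
  also have "sum f (S - {i}) = f j + sum f (S - {i} - {j})"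
    using assms by (intro sum.remove) auto
  also have "S - {i} - {j} = S - {i, j}" by auto
  finally show ?thesis by (simp add: add.assoc)
qed

text \<open>Only the terms at \<open>i\<close> and \<open>j\<close> change: the left point moves up
  and the right one moves down, so the gain is confined to a half-open rectangle. All rank formulas
  for reflections come from this one.\<close>

lemma rk_transpose:
  assumes "finite S" "i \<in> S" "j \<in> S" "i < j" "u i < u j"
  shows "rk S (u \<circ> transpose i j) p q =
    rk S u p q + of_bool (i \<le> p \<and> p < j \<and> u i < q \<and> q \<le> u j)"
proof -
  let ?f = "\<lambda>w c. of_bool (c \<le> p \<and> q \<le> w c) :: int"
  have "sum (?f (u \<circ> transpose i j)) (S - {i, j}) = sum (?f u) (S - {i, j})"
    by (intro sum.cong refl) (auto simp: transpose_def)
  then show ?thesis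
    unfolding rk_def using assms
    by (subst (1 2) sum_remove2[of S i j]) (auto simp: of_bool_def)
qed

lemma double_sum_remove2:
  fixes f :: "int \<Rightarrow> int \<Rightarrow> int"
  assumes "finite S" "i \<in> S" "j \<in> S" "i \<noteq> j"
  shows "(\<Sum>a\<in>S. \<Sum>b\<in>S. f a b) = f i i + f i j + f j i + f j j +
    (\<Sum>c\<in>S - {i, j}. f i c + f j c + f c i + f c j) + (\<Sum>a\<in>S - {i, j}. \<Sum>b\<in>S - {i, j}. f a b)"
proof -
  have "(\<Sum>b\<in>S. f a b) = f a i + f a j + (\<Sum>b\<in>S - {i, j}. f a b)" for a
    using assms by (rule sum_remove2)
  moreover have "(\<Sum>a\<in>S. \<Sum>b\<in>S. f a b) =
    (\<Sum>b\<in>S. f i b) + (\<Sum>b\<in>S. f j b) + (\<Sum>a\<in>S - {i, j}. \<Sum>b\<in>S. f a b)"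
    using assms by (rule sum_remove2)
  ultimately show ?thesis by (simp add: sum.distrib)
qed

text \<open>Pairs avoiding \<open>i\<close> and \<open>j\<close> are unaffected, and the pair itself
  gives 1. A third point inside the open rectangle becomes inverted with both \<open>i\<close> and
  \<open>j\<close>; any other third point contributes the same total before and after.\<close>

lemma invs_transpose:
  assumes "finite S" "i \<in> S" "j \<in> S" "i < j" "u i < u j" "inj_on u S"
  shows "invs S (u \<circ> transpose i j) = invs S u + 1 +
    2 * (\<Sum>c\<in>S. of_bool (i < c \<and> c < j \<and> u i < u c \<and> u c < u j))"
proof -
  define w where "w = u \<circ> transpose i j"
  let ?S = "S - {i, j}"
  let ?f = "\<lambda>w a b. of_bool (a < b \<and> w b < w a) :: int"
  have w: "w i = u j" "w j = u i" "\<And>c. c \<in> ?S \<Longrightarrow> w c = u c"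
    by (auto simp: w_def transpose_def)
  have ne: "i \<noteq> j" using assms by simp
  have inner: "(\<Sum>a\<in>?S. \<Sum>b\<in>?S. ?f w a b) = (\<Sum>a\<in>?S. \<Sum>b\<in>?S. ?f u a b)"
    by (intro sum.cong refl) (auto simp: w)
  have cross: "(\<Sum>c\<in>?S. ?f w i c + ?f w j c + ?f w c i + ?f w c j) =
    (\<Sum>c\<in>?S. ?f u i c + ?f u j c + ?f u c i + ?f u c j) +
    2 * (\<Sum>c\<in>?S. of_bool (i < c \<and> c < j \<and> u i < u c \<and> u c < u j))"
    unfolding sum_distrib_left sum.distrib[symmetric]
  proof (intro sum.cong refl)
    fix c assume c: "c \<in> ?S"
    have "u c \<noteq> u i" "u c \<noteq> u j" "c \<noteq> i" "c \<noteq> j"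
      using c assms by (auto dest: inj_onD)
    then show "?f w i c + ?f w j c + ?f w c i + ?f w c j = ?f u i c + ?f u j c + ?f u c i + ?f u c j +
      2 * of_bool (i < c \<and> c < j \<and> u i < u c \<and> u c < u j)"
      using w(1,2) w(3)[OF c] \<open>i < j\<close> \<open>u i < u j\<close>
      by (cases "c < i"; cases "c < j"; cases "u c < u i"; cases "u c < u j") simp_all
  qed
  have "(\<Sum>c\<in>S. of_bool (i < c \<and> c < j \<and> u i < u c \<and> u c < u j) :: int) =
    (\<Sum>c\<in>?S. of_bool (i < c \<and> c < j \<and> u i < u c \<and> u c < u j))"
    by (subst sum_remove2[OF assms(1-3) ne]) simp
  then show ?thesis
    unfolding invs_def w_def[symmetric] double_sum_remove2[OF assms(1-3) ne]
    using inner cross w(1,2) assms(4,5) by simp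
qed

lemma invs_transpose_empty_rect:
  assumes "finite S" "i \<in> S" "j \<in> S" "i < j" "u i < u j" "inj_on u S" "empty_rect S u i j"
  shows "invs S (u \<circ> transpose i j) = invs S u + 1"
proof -
  have "(\<Sum>c\<in>S. of_bool (i < c \<and> c < j \<and> u i < u c \<and> u c < u j) :: int) = 0"
    using assms(7) by (intro sum.neutral) (auto simp: empty_rect_def)
  then show ?thesis using invs_transpose[OF assms(1-6)] by simp
qed

lemma invs_transpose_less:
  assumes "finite S" "i \<in> S" "j \<in> S" "i < j" "u i < u j" "inj_on u S"
  shows "invs S u < invs S (u \<circ> transpose i j)"
proof -
  have "(\<Sum>c\<in>S. of_bool (i < c \<and> c < j \<and> u i < u c \<and> u c < u j) :: int) \<ge> 0"
    by (intro sum_nonneg) simp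
  then show ?thesis using invs_transpose[OF assms] by simp
qed

text \<open>Start at the first position \<open>a\<close> where \<open>u\<close> and \<open>v\<close>
  differ; there \<open>u a < v a\<close>. Let \<open>b\<close> be the next position whose
  \<open>u\<close>-value is above \<open>u a\<close> and at most \<open>v a\<close>. Being next
  makes the rectangle empty, and strictness comes from comparing ranks at the cut
  \<open>v a + 1\<close>.\<close>

lemma exists_empty_rect_below:
  assumes S: "finite S" and u: "u permutes S" and v: "v permutes S" and "u \<noteq> v"
    and le: "\<And>p q. rk S u p q \<le> rk S v p q"
  obtains i j where "i \<in> S" "j \<in> S" "i < j" "u i < u j" "empty_rect S u i j"
    "\<And>p q. i \<le> p \<Longrightarrow> p < j \<Longrightarrow> u i < q \<Longrightarrow> q \<le> u j \<Longrightarrow> rk S u p q < rk S v p q"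
proof -
  let ?D = "{c \<in> S. u c \<noteq> v c}"
  obtain x where "u x \<noteq> v x" using \<open>u \<noteq> v\<close> by blast
  then have "x \<in> ?D" using permutes_not_in[OF u, of x] permutes_not_in[OF v, of x] by (cases "x \<in> S") auto
  then have Dne: "?D \<noteq> {}" by blast
  define a where "a = Min ?D"
  have aD: "a \<in> ?D" unfolding a_def using S Dne by (intro Min_in) auto
  have agree: "u c = v c" if "c \<in> S" "c < a" for c
    using that Min_le[of ?D c] S unfolding a_def by fastforce
  let ?L = "{c \<in> S. c < a}" and ?G = "{c \<in> S. a \<le> c}"
  let ?f = "\<lambda>w p q c. of_bool (c \<le> p \<and> q \<le> w c) :: int"
  \<comment> \<open>Positions before \<open>a\<close> contribute equally for \<open>u\<close> and
    \<open>v\<close>, so the rank inequality passes to the positions from \<open>a\<close>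
    on.\<close>
  have split: "rk S w p q = sum (?f w p q) ?L + sum (?f w p q) ?G" for w p q
  proof -
    have "rk S w p q = sum (?f w p q) (?L \<union> ?G)" unfolding rk_def by (rule sum.cong) auto
    also have "\<dots> = sum (?f w p q) ?L + sum (?f w p q) ?G"
      by (rule sum.union_disjoint) (auto simp: S)
    finally show ?thesis .
  qed
  have L: "sum (?f u p q) ?L = sum (?f v p q) ?L" for p q
    by (intro sum.cong) (auto simp: agree)
  have G: "sum (?f u p q) ?G \<le> sum (?f v p q) ?G" for p q
    using le[of p q] split L by simp
  have Ga: "sum (?f w a q) ?G = of_bool (q \<le> w a)" for w q
  proof -
    have "sum (?f w a q) ?G = ?f w a q a + sum (?f w a q) (?G - {a})"
      using S aD by (intro sum.remove) auto
    also have "sum (?f w a q) (?G - {a}) = 0" by (intro sum.neutral) auto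
    finally show ?thesis by simp
  qed
  have "u a \<le> v a" using G[of a "u a"] unfolding Ga by (cases "u a \<le> v a") auto
  then have uva: "u a < v a" using aD by simp
  let ?E = "{c \<in> S. a < c \<and> u a < u c \<and> u c \<le> v a}"
  \<comment> \<open>The position where \<open>u\<close> takes the value \<open>v a\<close> comes
    after \<open>a\<close>, since \<open>u\<close> and \<open>v\<close> agree before
    \<open>a\<close> and \<open>v\<close> is injective. It witnesses that \<open>b\<close>
    exists.\<close>
  obtain c0 where c0: "u c0 = v a" using u by (metis permutes_def)
  have va: "v a \<in> S" using aD v by (simp add: permutes_in_image)
  have "c0 \<in> S" using va c0 u by (metis permutes_in_image)
  moreover have "\<not> c0 < a"
  proof
    assume "c0 < a"
    then have "v c0 = v a" using agree[OF \<open>c0 \<in> S\<close>] c0 by simp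
    then show False using \<open>c0 < a\<close> permutes_inj[OF v] by (auto dest: injD)
  qed
  moreover have "c0 \<noteq> a" using c0 uva by auto
  ultimately have "c0 \<in> ?E" using c0 uva by auto
  then have Ene: "?E \<noteq> {}" by blast
  define b where "b = Min ?E"
  have bE: "b \<in> ?E" unfolding b_def using S Ene by (intro Min_in) auto
  have bmin: "\<not> (u a < u c \<and> u c \<le> v a)" if "c \<in> S" "a < c" "c < b" for c
    using that Min_le[of ?E c] S unfolding b_def by fastforce
  show ?thesis
  proof (rule that)
    show "a \<in> S" "b \<in> S" "a < b" "u a < u b" using aD bE by auto
    show "empty_rect S u a b" unfolding empty_rect_def using bmin bE by force
    fix p q assume pq: "a \<le> p" "p < b" "u a < q" "q \<le> u b"
    \<comment> \<open>No position from \<open>a\<close> to \<open>p\<close> has a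
      \<open>u\<close>-value between \<open>q\<close> and \<open>v a\<close>, so for
      \<open>u\<close> the cut can be raised to \<open>v a + 1\<close>. Lowering it again for
      \<open>v\<close> gains the point at \<open>a\<close>.\<close>
    have "sum (?f u p q) ?G = sum (?f u p (v a + 1)) ?G"
    proof (intro sum.cong refl)
      fix c assume "c \<in> ?G"
      then show "?f u p q c = ?f u p (v a + 1) c"
        using pq bE bmin[of c] by (cases "c = a") (auto simp: of_bool_def)
    qed
    also have "\<dots> \<le> sum (?f v p (v a + 1)) ?G" by (rule G)
    also have "\<dots> < sum (\<lambda>c. ?f v p (v a + 1) c + of_bool (c = a)) ?G"
    proof -
      have "sum (\<lambda>c. of_bool (c = a) :: int) ?G = 1"
        using S aD by (subst sum.remove[of _ a]) auto
      then show ?thesis by (simp add: sum.distrib)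
    qed
    also have "\<dots> \<le> sum (?f v p q) ?G"
      using pq bE by (intro sum_mono) (auto simp: of_bool_def)
    finally show "rk S u p q < rk S v p q" using split L by simp
  qed
qed

section \<open>Signed permutations, lengths and reflections\<close>

lemma mem_signed_interval: "x \<in> signed_interval k \<longleftrightarrow> - int k \<le> x \<and> x \<le> int k \<and> x \<noteq> 0"
  by (auto simp: signed_interval_def)

lemma finite_signed_interval [simp]: "finite (signed_interval k)"
  by (simp add: signed_interval_def)

lemma uminus_mem_signed_interval [simp]: "- x \<in> signed_interval k \<longleftrightarrow> x \<in> signed_interval k"
  by (auto simp: mem_signed_interval)

lemma B_permutes: "w \<in> B k \<Longrightarrow> w permutes signed_interval k"
  by (simp add: B_def)

lemma B_inj: "w \<in> B k \<Longrightarrow> w x = w y \<longleftrightarrow> x = y"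
  using permutes_inj[OF B_permutes] by (metis injD)

lemma B_mem [simp]: "w \<in> B k \<Longrightarrow> w x \<in> signed_interval k \<longleftrightarrow> x \<in> signed_interval k"
  using B_permutes by (simp add: permutes_in_image)

lemma B_odd: "w (- a) = - w a" if "w \<in> B k"
proof (cases "a \<in> signed_interval k")
  case True
  then show ?thesis using that by (simp add: B_def)
next
  case False
  then have "- a \<notin> signed_interval k" by simp
  then show ?thesis using False permutes_not_in[OF B_permutes[OF that]] by simp
qed

lemma B_I:
  assumes "w permutes signed_interval k" "\<And>a. w (- a) = - w a"
  shows "w \<in> B k"
  using assms by (simp add: B_def)

lemma B_compose: "u \<in> B k \<Longrightarrow> w \<in> B k \<Longrightarrow> u \<circ> w \<in> B k"
  by (rule B_I) (auto simp: B_permutes permutes_compose B_odd)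

lemma B_surj: assumes "w \<in> B k" obtains x where "w x = y"
  using permutes_surj[OF B_permutes[OF assms]] by (metis surjD)

section \<open>Point reflection of rank functions and the length formula\<close>

lemma sum_signed_interval_uminus:
  "(\<Sum>c\<in>signed_interval k. f (- c)) = (\<Sum>c\<in>signed_interval k. f c)"
  by (rule sum.reindex_bij_witness[of _ uminus uminus]) auto

text \<open>Negation turns one quadrant into the opposite one, and inclusion-exclusion brings back
  the original. The correction is independent of \<open>u\<close> because the values of
  \<open>u\<close> run through the whole interval; hence rank differences of two signed permutations
  are invariant under the reflection.\<close>

lemma rk_uminus:
  assumes "u \<in> B k"
  shows "rk (signed_interval k) u (- p - 1) (1 - q) = rk (signed_interval k) u p q +
    (\<Sum>c\<in>signed_interval k. 1 - of_bool (c \<le> p) - of_bool (q \<le> c))"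
proof -
  let ?S = "signed_interval k"
  have perm: "(\<Sum>c\<in>?S. of_bool (q \<le> u c) :: int) = (\<Sum>c\<in>?S. of_bool (q \<le> c))"
    using sum.permute[OF B_permutes[OF assms], of "\<lambda>c. of_bool (q \<le> c) :: int"] by (simp add: o_def)
  have "rk ?S u (- p - 1) (1 - q) = (\<Sum>c\<in>?S. of_bool (- c \<le> - p - 1 \<and> 1 - q \<le> u (- c)))"
    unfolding rk_def by (rule sum_signed_interval_uminus[symmetric])
  also have "\<dots> = (\<Sum>c\<in>?S. of_bool (c \<le> p \<and> q \<le> u c) + 1 - of_bool (c \<le> p) - of_bool (q \<le> u c))"
    by (intro sum.cong refl) (auto simp: B_odd[OF assms] of_bool_def)
  also have "\<dots> = rk ?S u p q + (\<Sum>c\<in>?S. 1 - of_bool (c \<le> p) - of_bool (q \<le> c))"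
    unfolding rk_def by (simp add: sum.distrib sum_subtractf perm)
  finally show ?thesis .
qed

lemma rk_uminus_less_iff:
  assumes "u \<in> B k" "v \<in> B k"
  shows "rk (signed_interval k) u (- p - 1) (1 - q) < rk (signed_interval k) v (- p - 1) (1 - q) \<longleftrightarrow>
    rk (signed_interval k) u p q < rk (signed_interval k) v p q"
  by (simp add: rk_uminus assms)

lemma sum_signed_interval_pos:
  "(\<Sum>c\<in>signed_interval k. f c) = (\<Sum>c\<in>{1..int k}. f c + f (- c) :: 'a::comm_monoid_add)"
proof -
  have S: "signed_interval k = {1..int k} \<union> uminus ` {1..int k}"
    by (auto simp: mem_signed_interval image_iff)
  have "(\<Sum>c\<in>signed_interval k. f c) = (\<Sum>c\<in>{1..int k}. f c) + (\<Sum>c\<in>uminus ` {1..int k}. f c)"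
    unfolding S by (intro sum.union_disjoint) auto
  also have "(\<Sum>c\<in>uminus ` {1..int k}. f c) = (\<Sum>c\<in>{1..int k}. f (- c))"
    by (subst sum.reindex) (auto simp: inj_on_def)
  finally show ?thesis by (simp add: sum.distrib)
qed

lemma neg_B_eq_rk: "int (neg_B k w) = rk (signed_interval k) w 0 1" if "w \<in> B k"
proof -
  have "rk (signed_interval k) w 0 1 = (\<Sum>c\<in>{1..int k}. of_bool (w c < 0))"
    unfolding rk_def sum_signed_interval_pos
    by (intro sum.cong refl) (auto simp: B_odd[OF that] of_bool_def)
  also have "\<dots> = int (neg_B k w)"
    by (simp add: neg_B_def Int_def conj_commute)
  finally show ?thesis by simp
qed

lemma card_pairs_eq_sum:
  "int (card {(a, b). 1 \<le> a \<and> a < b \<and> b \<le> int k \<and> Q a b}) =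
    (\<Sum>a\<in>{1..int k}. \<Sum>b\<in>{1..int k}. of_bool (a < b \<and> Q a b))"
proof -
  have "(\<Sum>a\<in>{1..int k}. \<Sum>b\<in>{1..int k}. of_bool (a < b \<and> Q a b) :: int) =
    (\<Sum>x\<in>{1..int k} \<times> {1..int k}. of_bool (fst x < snd x \<and> Q (fst x) (snd x)))"
    by (simp only: sum.cartesian_product split_def)
  also have "\<dots> = int (card ({1..int k} \<times> {1..int k} \<inter> {x. fst x < snd x \<and> Q (fst x) (snd x)}))"
    by (rule sum_of_bool_eq) auto
  also have "{1..int k} \<times> {1..int k} \<inter> {x. fst x < snd x \<and> Q (fst x) (snd x)} =
    {(a, b). 1 \<le> a \<and> a < b \<and> b \<le> int k \<and> Q a b}" by auto
  finally show ?thesis by simp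
qed

text \<open>Split the pairs by sign. Two positive positions and two negative ones each count
  \<open>inv_B\<close>. A negative position \<open>- a\<close> and a positive \<open>b\<close> are
  inverted iff \<open>w a + w b < 0\<close>, which counts \<open>nsp_B\<close> twice off the
  diagonal and \<open>neg_B\<close> on it.\<close>

lemma invs_eq:
  assumes "w \<in> B k"
  shows "invs (signed_interval k) w = 2 * int (inv_B k w) + 2 * int (nsp_B k w) + int (neg_B k w)"
proof -
  let ?P = "{1..int k}"
  have diag: "(\<Sum>a\<in>?P. \<Sum>b\<in>?P. of_bool (a = b \<and> w a < 0) :: int) = int (neg_B k w)"
  proof -
    have "(\<Sum>b\<in>?P. of_bool (a = b \<and> w a < 0) :: int) = of_bool (w a < 0)" if "a \<in> ?P" for a
      using that by (subst sum.remove[of _ a]) (auto intro!: sum.neutral)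
    then show ?thesis by (simp add: neg_B_def Int_def conj_commute)
  qed
  have "invs (signed_interval k) w = (\<Sum>a\<in>?P. \<Sum>b\<in>?P. of_bool (a < b \<and> w b < w a) +
     of_bool (b < a \<and> w a < w b) + of_bool (a < b \<and> w a + w b < 0) +
     of_bool (b < a \<and> w b + w a < 0) + of_bool (a = b \<and> w a < 0))"
    unfolding invs_def sum_signed_interval_pos sum.distrib[symmetric]
    by (intro sum.cong refl) (auto simp: B_odd[OF assms] of_bool_def)
  also have "\<dots> = (\<Sum>a\<in>?P. \<Sum>b\<in>?P. of_bool (a < b \<and> w b < w a)) +
     (\<Sum>b\<in>?P. \<Sum>a\<in>?P. of_bool (b < a \<and> w a < w b)) +
     (\<Sum>a\<in>?P. \<Sum>b\<in>?P. of_bool (a < b \<and> w a + w b < 0)) +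
     (\<Sum>b\<in>?P. \<Sum>a\<in>?P. of_bool (b < a \<and> w b + w a < 0)) + int (neg_B k w)"
    by (simp only: sum.distrib diag)
      (simp only: sum.swap[of "\<lambda>a b. of_bool (b < a \<and> w a < w b)"]
         sum.swap[of "\<lambda>a b. of_bool (b < a \<and> w b + w a < 0)"])
  finally show ?thesis
    by (simp add: inv_B_def nsp_B_def card_pairs_eq_sum)
qed

text \<open>Expresses the Coxeter length by quantities that ordinary transpositions of the interval
  control.\<close>

lemma length_B_eq:
  assumes "w \<in> B k"
  shows "2 * int (length_B k w) = invs (signed_interval k) w + rk (signed_interval k) w 0 1"
  using invs_eq[OF assms] neg_B_eq_rk[OF assms] by (simp add: length_B_def)

section \<open>Reflections as sign changes and signed transpositions\<close>

text \<open>For \<open>j = - i\<close> the two factors cancel, so the sign changes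
  \<open>transpose i (- i)\<close> have to be treated as a second family of reflections.\<close>

definition signed_transpose :: "int \<Rightarrow> int \<Rightarrow> int \<Rightarrow> int" where
  "signed_transpose i j = transpose i j \<circ> transpose (- i) (- j)"

lemma transpose_uminus_in_B: "i \<in> signed_interval k \<Longrightarrow> transpose i (- i) \<in> B k"
  by (rule B_I) (auto intro!: permutes_swap_id simp: transpose_def)

lemma signed_transpose_in_B:
  assumes "i \<in> signed_interval k" "j \<in> signed_interval k" "j \<noteq> - i"
  shows "signed_transpose i j \<in> B k"
proof (rule B_I)
  show "signed_transpose i j permutes signed_interval k"
    unfolding signed_transpose_def using assms
    by (intro permutes_compose permutes_swap_id) auto
  have "i \<noteq> 0" "j \<noteq> 0" using assms by (auto simp: mem_signed_interval)
  then show "signed_transpose i j (- a) = - signed_transpose i j a" for a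
    using assms(3) by (auto simp: signed_transpose_def transpose_def)
qed

lemma conj_transpose:
  assumes "bij w"
  shows "w \<circ> transpose a b \<circ> inv w = transpose (w a) (w b)"
proof -
  have "w \<circ> transpose a b = transpose (w a) (w b) \<circ> w"
    using transpose_comp_eq[OF assms, of "w a" "w b"] assms by (simp add: bij_is_inj)
  moreover have "w \<circ> inv w = id" using assms by (metis bij_is_surj surj_iff)
  ultimately show ?thesis by (simp add: comp_assoc)
qed

lemma conj_signed_transpose:
  assumes "w \<in> B k"
  shows "w \<circ> signed_transpose a b \<circ> inv w = signed_transpose (w a) (w b)"
proof -
  have bij: "bij w" using B_permutes[OF assms] by (rule permutes_bij)
  have "w \<circ> signed_transpose a b \<circ> inv w =
    (w \<circ> transpose a b \<circ> inv w) \<circ> (w \<circ> transpose (- a) (- b) \<circ> inv w)"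
    using bij by (auto simp: fun_eq_iff signed_transpose_def bij_is_inj)
  then show ?thesis unfolding conj_transpose[OF bij] by (simp add: signed_transpose_def B_odd[OF assms])
qed

lemma gens_B_eq: "gens_B k = {transpose 1 (- 1)} \<union> {signed_transpose a (a + 1) | a. a \<in> {1..int k - 1}}"
  by (simp add: gens_B_def signed_transpose_def)

lemma reflections_B_I: "w \<in> B k \<Longrightarrow> s \<in> gens_B k \<Longrightarrow> w \<circ> s \<circ> inv w \<in> reflections_B k"
  unfolding reflections_B_def by blast

lemma transpose_uminus_in_reflections_B:
  assumes "i \<in> signed_interval k"
  shows "transpose i (- i) \<in> reflections_B k"
proof -
  have one: "1 \<in> signed_interval k" using assms by (auto simp: mem_signed_interval)
  obtain w where w: "w \<in> B k" "w 1 = i"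
  proof (cases "i = - 1")
    case True
    then show ?thesis using that[OF transpose_uminus_in_B[OF one]] by simp
  next
    case False
    then show ?thesis using that[OF signed_transpose_in_B[OF one assms]] assms
      by (auto simp: signed_transpose_def transpose_def mem_signed_interval)
  qed
  have "w \<circ> transpose 1 (- 1) \<circ> inv w = transpose i (- i)"
    using conj_transpose[OF permutes_bij[OF B_permutes[OF w(1)]]] w B_odd[OF w(1), of 1] by metis
  then show ?thesis using reflections_B_I[OF w(1), of "transpose 1 (- 1)"] by (simp add: gens_B_eq)
qed

text \<open>First send 1 to \<open>i\<close>, then precompose with an element that fixes 1 and sends
  2 to the preimage of \<open>j\<close>. This exhibits \<open>signed_transpose i j\<close> as a
  conjugate of the generator exchanging 1 and 2.\<close>

lemma B_extend_two_values:
  assumes "i \<in> signed_interval k" "j \<in> signed_interval k" "j \<noteq> i" "j \<noteq> - i"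
  obtains w where "w \<in> B k" "w 1 = i" "w 2 = j"
proof -
  have one: "1 \<in> signed_interval k" using assms by (auto simp: mem_signed_interval)
  have two: "2 \<in> signed_interval k" using assms by (auto simp: mem_signed_interval)
  \<comment> \<open>Moving nothing but \<open>a\<close>, \<open>b\<close> and their negatives is
    what keeps 1 fixed in the second stage.\<close>
  have ex: "\<exists>w\<in>B k. w a = b \<and> (\<forall>c. c \<noteq> a \<and> c \<noteq> - a \<and> c \<noteq> b \<and> c \<noteq> - b \<longrightarrow> w c = c)"
    if "a \<in> signed_interval k" "b \<in> signed_interval k" for a b
  proof (cases "b = - a")
    case True
    then show ?thesis using transpose_uminus_in_B[OF that(1)]
      by (intro bexI[of _ "transpose a (- a)"]) (auto simp: transpose_def)
  next
    case False
    then show ?thesis using signed_transpose_in_B[OF that] that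
      by (intro bexI[of _ "signed_transpose a b"])
        (auto simp: signed_transpose_def transpose_def mem_signed_interval)
  qed
  obtain w1 where w1: "w1 \<in> B k" "w1 1 = i" using ex[OF one assms(1)] by blast
  obtain x where x: "w1 x = j" using B_surj[OF w1(1)] by blast
  have xS: "x \<in> signed_interval k" using x assms(2) B_mem[OF w1(1), of x] by simp
  have "x \<noteq> 1" "x \<noteq> - 1" using x w1 assms B_odd[OF w1(1), of 1] by auto
  moreover obtain w2 where w2: "w2 \<in> B k" "w2 2 = x"
    "\<And>c. c \<noteq> 2 \<and> c \<noteq> - 2 \<and> c \<noteq> x \<and> c \<noteq> - x \<Longrightarrow> w2 c = c" using ex[OF two xS] by blast
  ultimately have "w2 1 = 1" by simp
  then show ?thesis using that[OF B_compose[OF w1(1) w2(1)]] w1 w2 x by simp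
qed

lemma signed_transpose_in_reflections_B:
  assumes "i \<in> signed_interval k" "j \<in> signed_interval k" "j \<noteq> i" "j \<noteq> - i"
  shows "signed_transpose i j \<in> reflections_B k"
proof -
  obtain w where w: "w \<in> B k" "w 1 = i" "w 2 = j" using B_extend_two_values[OF assms] .
  have "1 \<in> {1..int k - 1}" using assms by (auto simp: mem_signed_interval)
  then have "signed_transpose 1 (1 + 1) \<in> gens_B k" unfolding gens_B_eq by blast
  moreover have "w \<circ> signed_transpose 1 (1 + 1) \<circ> inv w = signed_transpose i j"
    using conj_signed_transpose[OF w(1), of 1 2] w by simp
  ultimately show ?thesis using reflections_B_I[OF w(1)] by metis
qed

text \<open>Conjugation carries each kind of generator into one of the two families. As
  \<open>gens_B 0\<close> still contains \<open>transpose 1 (- 1)\<close>, the bound on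
  \<open>k\<close> is what places 1 inside the interval.\<close>

lemma reflections_B_cases:
  assumes "t \<in> reflections_B k" "k \<ge> 1"
  obtains i where "i \<in> signed_interval k" "t = transpose i (- i)"
  | i j where "i \<in> signed_interval k" "j \<in> signed_interval k" "j \<noteq> i" "j \<noteq> - i" "t = signed_transpose i j"
proof -
  obtain w s where t: "t = w \<circ> s \<circ> inv w" and w: "w \<in> B k" and s: "s \<in> gens_B k"
    using assms(1) by (auto simp: reflections_B_def)
  from s consider "s = transpose 1 (- 1)" | a where "a \<in> {1..int k - 1}" "s = signed_transpose a (a + 1)"
    unfolding gens_B_eq by blast
  then show ?thesis
  proof cases
    case 1
    have "1 \<in> signed_interval k" using assms(2) by (simp add: mem_signed_interval)
    then have "w 1 \<in> signed_interval k" using w by simp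
    moreover have "t = transpose (w 1) (- w 1)"
      using conj_transpose[OF permutes_bij[OF B_permutes[OF w]], of 1 "-1"] B_odd[OF w, of 1] t 1 by simp
    ultimately show ?thesis using that(1) by blast
  next
    case 2
    have "a \<in> signed_interval k" "a + 1 \<in> signed_interval k" using 2 by (auto simp: mem_signed_interval)
    then have "w a \<in> signed_interval k" "w (a + 1) \<in> signed_interval k" using w by simp_all
    moreover have "w (a + 1) \<noteq> w a" "w (a + 1) \<noteq> - w a"
      using w 2 by (auto simp: B_inj B_odd[OF w, symmetric])
    ultimately show ?thesis using that(2) conj_signed_transpose[OF w] t 2 by metis
  qed
qed

section \<open>The rank criterion for the Bruhat order\<close>

lemma rk_transpose_uminus:
  assumes "u \<in> B k" "i \<in> signed_interval k" "0 < i" "0 < u i"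
  shows "rk (signed_interval k) (u \<circ> transpose i (- i)) p q = rk (signed_interval k) u p q +
    of_bool (- i \<le> p \<and> p < i \<and> - u i < q \<and> q \<le> u i)"
  using rk_transpose[of "signed_interval k" "- i" i u p q] assms
  by (simp add: transpose_commute B_odd[OF assms(1)])

lemma signed_transpose_eq: "u \<circ> signed_transpose i j = (u \<circ> transpose i j) \<circ> transpose (- j) (- i)"
  by (simp add: signed_transpose_def comp_assoc transpose_commute)

lemma transpose_apply_uminus:
  fixes i j :: int
  assumes "u \<in> B k" "i \<in> signed_interval k" "j \<in> signed_interval k" "j \<noteq> i" "j \<noteq> - i"
  shows "(u \<circ> transpose i j) (- j) = - u j" "(u \<circ> transpose i j) (- i) = - u i"
  using assms(2-) B_odd[OF assms(1)] by (auto simp: transpose_def mem_signed_interval)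

text \<open>The first transposition leaves the values at \<open>- i\<close> and \<open>- j\<close>
  alone, so the second adds the reflected rectangle. The two rectangles may overlap, and there the
  rank rises by 2.\<close>

lemma rk_signed_transpose:
  assumes "u \<in> B k" "i \<in> signed_interval k" "j \<in> signed_interval k" "i < j" "j \<noteq> - i" "u i < u j"
  shows "rk (signed_interval k) (u \<circ> signed_transpose i j) p q = rk (signed_interval k) u p q +
    of_bool (i \<le> p \<and> p < j \<and> u i < q \<and> q \<le> u j) +
    of_bool (- j \<le> p \<and> p < - i \<and> - u j < q \<and> q \<le> - u i)"
proof -
  let ?w = "u \<circ> transpose i j"
  have w: "?w (- j) = - u j" "?w (- i) = - u i"
    using transpose_apply_uminus[OF assms(1-3)] assms(4,5) by simp_all
  have "rk (signed_interval k) (?w \<circ> transpose (- j) (- i)) p q = rk (signed_interval k) ?w p q +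
    of_bool (- j \<le> p \<and> p < - i \<and> ?w (- j) < q \<and> q \<le> ?w (- i))"
    using assms w by (intro rk_transpose) simp_all
  then show ?thesis
    using rk_transpose[of "signed_interval k" i j u p q] assms by (simp only: signed_transpose_eq w) simp
qed

lemma B_inj_on: "u \<in> B k \<Longrightarrow> inj_on u A"
  by (simp add: inj_on_def B_inj)

lemma invs_transpose_uminus:
  assumes "u \<in> B k" "i \<in> signed_interval k" "0 < i" "0 < u i"
  shows "invs (signed_interval k) u < invs (signed_interval k) (u \<circ> transpose i (- i))"
    and "empty_rect (signed_interval k) u (- i) i \<Longrightarrow>
      invs (signed_interval k) (u \<circ> transpose i (- i)) = invs (signed_interval k) u + 1"
  using invs_transpose_less[of "signed_interval k" "- i" i u]
    invs_transpose_empty_rect[of "signed_interval k" "- i" i u] assms B_inj_on[OF assms(1)]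
  by (simp_all add: transpose_commute B_odd[OF assms(1)])

lemma invs_signed_transpose_less:
  assumes "u \<in> B k" "i \<in> signed_interval k" "j \<in> signed_interval k" "i < j" "j \<noteq> - i" "u i < u j"
  shows "invs (signed_interval k) u < invs (signed_interval k) (u \<circ> signed_transpose i j)"
proof -
  let ?S = "signed_interval k"
  let ?w = "u \<circ> transpose i j"
  have w: "?w (- j) = - u j" "?w (- i) = - u i"
    using transpose_apply_uminus[OF assms(1-3)] assms(4,5) by simp_all
  have "inj_on ?w ?S" using B_inj_on[OF assms(1)] by (simp add: comp_inj_on)
  then have "invs ?S ?w < invs ?S (?w \<circ> transpose (- j) (- i))"
    using assms w by (intro invs_transpose_less) simp_all
  then show ?thesis
    using invs_transpose_less[of ?S i j u] B_inj_on[OF assms(1)] assms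
    by (simp add: signed_transpose_eq)
qed

text \<open>
  The sign hypothesis says that the rectangle is disjoint from its point reflection, which is
  what keeps the second transposition from creating further inversions.
\<close>
lemma invs_signed_transpose_empty_rect:
  assumes "u \<in> B k" "i \<in> signed_interval k" "j \<in> signed_interval k" "i < j" "0 < i + j" "u i < u j"
    and empty: "empty_rect (signed_interval k) u i j" and "0 < i \<or> 0 < u i \<or> u j < 0"
  shows "invs (signed_interval k) (u \<circ> signed_transpose i j) = invs (signed_interval k) u + 2"
proof -
  let ?S = "signed_interval k"
  let ?w = "u \<circ> transpose i j"
  have w: "?w (- j) = - u j" "?w (- i) = - u i"
    using transpose_apply_uminus[OF assms(1-3)] assms(4,5) by simp_all
  have "empty_rect ?S ?w (- j) (- i)"
    unfolding empty_rect_def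
  proof (intro ballI notI)
    fix c assume c: "c \<in> ?S" and r: "- j < c \<and> c < - i \<and> ?w (- j) < ?w c \<and> ?w c < ?w (- i)"
    note r = r[unfolded w]
    have "c \<noteq> j" using r assms(5) by auto
    moreover have "c \<noteq> i" using r assms(8) by (auto simp: mem_signed_interval)
    ultimately have "?w c = u c" by simp
    then have "i < - c \<and> - c < j \<and> u i < u (- c) \<and> u (- c) < u j"
      using r by (auto simp: B_odd[OF assms(1)])
    then show False using empty c unfolding empty_rect_def by (metis uminus_mem_signed_interval)
  qed
  moreover have "inj_on ?w ?S" using B_inj_on[OF assms(1)] by (simp add: comp_inj_on)
  ultimately have "invs ?S (?w \<circ> transpose (- j) (- i)) = invs ?S ?w + 1"
    using assms w by (intro invs_transpose_empty_rect) simp_all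
  then show ?thesis
    using invs_transpose_empty_rect[of ?S i j u] B_inj_on[OF assms(1)] assms
    by (simp add: signed_transpose_eq)
qed

section \<open>Covers that stay below a given element\<close>

text \<open>Good rectangles are closed under point reflection, so one may take
  \<open>0 \<le> i + j\<close>. Such a rectangle is centred, or misses its reflection, or overlaps
  it with \<open>i < 0\<close> and \<open>u i < 0 < u j\<close>; in the last case the centred
  rectangle of \<open>- i\<close> replaces it.\<close>

lemma exists_symmetric_empty_rect_below:
  assumes u: "u \<in> B k" and v: "v \<in> B k" and "u \<noteq> v"
    and le: "\<And>p q. rk (signed_interval k) u p q \<le> rk (signed_interval k) v p q"
  obtains
    (central) i where "i \<in> signed_interval k" "0 < i" "0 < u i" "empty_rect (signed_interval k) u (- i) i"
      "\<And>p q. - i \<le> p \<Longrightarrow> p < i \<Longrightarrow> - u i < q \<Longrightarrow> q \<le> u i \<Longrightarrow>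
        rk (signed_interval k) u p q < rk (signed_interval k) v p q"
  | (disjoint) i j where "i \<in> signed_interval k" "j \<in> signed_interval k" "i < j" "0 < i + j" "u i < u j"
      "0 < i \<or> 0 < u i \<or> u j < 0" "empty_rect (signed_interval k) u i j"
      "\<And>p q. i \<le> p \<Longrightarrow> p < j \<Longrightarrow> u i < q \<Longrightarrow> q \<le> u j \<Longrightarrow>
        rk (signed_interval k) u p q < rk (signed_interval k) v p q"
proof -
  let ?S = "signed_interval k"
  define good where "good i j \<longleftrightarrow> i \<in> ?S \<and> j \<in> ?S \<and> i < j \<and> u i < u j \<and> empty_rect ?S u i j \<and>
    (\<forall>p q. i \<le> p \<and> p < j \<and> u i < q \<and> q \<le> u j \<longrightarrow> rk ?S u p q < rk ?S v p q)" for i j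
  note odd = B_odd[OF u]
  have flip: "rk ?S u p q < rk ?S v p q" if "rk ?S u (- p - 1) (1 - q) < rk ?S v (- p - 1) (1 - q)" for p q
    using that rk_uminus_less_iff[OF u v] by blast
  have sym: "good (- j) (- i)" if "good i j" for i j
  proof -
    have "empty_rect ?S u (- j) (- i)" unfolding empty_rect_def
    proof (intro ballI notI)
      fix c assume c: "c \<in> ?S" and r: "- j < c \<and> c < - i \<and> u (- j) < u c \<and> u c < u (- i)"
      then have "i < - c \<and> - c < j \<and> u i < u (- c) \<and> u (- c) < u j" by (auto simp: odd)
      then show False using that c unfolding good_def empty_rect_def by (metis uminus_mem_signed_interval)
    qed
    moreover have "rk ?S u p q < rk ?S v p q"
      if "- j \<le> p" "p < - i" "u (- j) < q" "q \<le> u (- i)" for p q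
      by (rule flip) (use that \<open>good i j\<close> in \<open>auto simp: good_def odd\<close>)
    ultimately show ?thesis using that by (auto simp: good_def odd)
  qed
  have "\<exists>i j. good i j"
    using exists_empty_rect_below[OF finite_signed_interval B_permutes[OF u] B_permutes[OF v] \<open>u \<noteq> v\<close> le]
    unfolding good_def by (metis (no_types, lifting))
  then obtain i j where ij: "good i j" "0 \<le> i + j"
    using sym by (metis add.commute add_nonneg_nonneg minus_add_distrib neg_0_le_iff_le linorder_le_cases)
  note g = ij(1)[unfolded good_def]
  show ?thesis
  proof (cases "i + j = 0")
    case True
    then have i: "i = - j" by simp
    show ?thesis
      by (rule central[of j]) (use g in \<open>auto simp: i odd\<close>)
  next
    case False
    then have pos: "0 < i + j" using ij(2) by simp
    show ?thesis
    proof (cases "0 < i \<or> 0 < u i \<or> u j < 0")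
      case True
      show ?thesis by (rule disjoint[of i j]) (use g pos True in auto)
    next
      case False
      have ne: "i \<noteq> 0" "u i \<noteq> 0" "u j \<noteq> 0" "j \<noteq> - i"
        using g u pos B_mem[OF u, of i] B_mem[OF u, of j] by (auto simp: mem_signed_interval)
      then have neg: "i < 0" "u i < 0" "0 < u j" using False by auto
      \<comment> \<open>The point at \<open>- i\<close> has position strictly between
        \<open>i\<close> and \<open>j\<close> and positive value, so emptiness of the rectangle
        pushes it above \<open>u j\<close>.\<close>
      have "u (- i) \<noteq> u j" using ne B_inj[OF u] by auto
      moreover have "\<not> (u i < u (- i) \<and> u (- i) < u j)"
        using g neg pos unfolding empty_rect_def by (smt (verit) uminus_mem_signed_interval)
      ultimately have big: "u j < - u i" using neg by (auto simp: odd)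
      text \<open>The box centred at the origin is covered by the rectangle and its point reflection.\<close>
      show ?thesis
      proof (rule central[of "- i"])
        show "- i \<in> ?S" "0 < - i" "0 < u (- i)" using g neg by (auto simp: odd)
        show "empty_rect ?S u (- (- i)) (- i)" unfolding empty_rect_def
        proof (intro ballI notI)
          fix c assume c: "c \<in> ?S"
            and r: "- (- i) < c \<and> c < - i \<and> u (- (- i)) < u c \<and> u c < u (- i)"
          have "c \<noteq> j" "- c \<noteq> j" using r pos by auto
          then have "u c \<noteq> u j" "u (- c) \<noteq> u j" using B_inj[OF u] by auto
          then have "u i < u c \<and> u c < u j \<or> u i < u (- c) \<and> u (- c) < u j"
            using r neg by (auto simp: odd)
          moreover have "i < c \<and> c < j" "i < - c \<and> - c < j" using r pos by auto
          ultimately show False using g c unfolding empty_rect_def by (metis uminus_mem_signed_interval)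
        qed
        fix p q assume pq: "- (- i) \<le> p" "p < - i" "- u (- i) < q" "q \<le> u (- i)"
        show "rk ?S u p q < rk ?S v p q"
        proof (cases "q \<le> u j")
          case True
          then show ?thesis using g pq pos by (auto simp: odd)
        next
          case False
          show ?thesis by (rule flip) (use g pq pos False neg in \<open>auto simp: odd\<close>)
        qed
      qed
    qed
  qed
qed

text \<open>The numerical conclusion will make \<open>length_W\<close> rise by exactly one when the
  moved positions are deleted from \<open>T\<close>: a sign change adds 1 to \<open>invs\<close> and
  1 to the number of negative values, a disjoint pair adds 2 and 0. The last conclusion keeps the
  constraints at fixed positions intact.\<close>

lemma exists_bruhat_cover_below:
  assumes u: "u \<in> B k" and v: "v \<in> B k" and "u \<noteq> v"
    and le: "\<And>p q. rk (signed_interval k) u p q \<le> rk (signed_interval k) v p q"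
  obtains t where "t \<in> reflections_B k" "u \<circ> t \<in> B k"
    "\<And>p q. rk (signed_interval k) u p q \<le> rk (signed_interval k) (u \<circ> t) p q"
    "\<And>p q. rk (signed_interval k) (u \<circ> t) p q \<le> rk (signed_interval k) v p q"
    "invs (signed_interval k) u < invs (signed_interval k) (u \<circ> t)"
    "3 * (invs (signed_interval k) (u \<circ> t) - invs (signed_interval k) u) +
       (rk (signed_interval k) (u \<circ> t) 0 1 - rk (signed_interval k) u 0 1) =
     2 * int (card {c \<in> {1..int k}. t c \<noteq> c}) + 2"
    "\<And>c p q. c \<in> signed_interval k \<Longrightarrow> t c = c \<Longrightarrow> p = c \<or> p = c - 1 \<Longrightarrow> q = u c \<or> q = u c + 1 \<Longrightarrow>
      rk (signed_interval k) (u \<circ> t) p q = rk (signed_interval k) u p q"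
  using u v \<open>u \<noteq> v\<close> le
proof (cases rule: exists_symmetric_empty_rect_below)
  let ?S = "signed_interval k"
  note odd = B_odd[OF u]
  case (central i)
  have moved: "{c \<in> {1..int k}. transpose i (- i) c \<noteq> c} = {i}"
    using central by (auto simp: transpose_def mem_signed_interval)
  note rk = rk_transpose_uminus[OF u central(1-3)]
  show ?thesis
  proof (rule that[of "transpose i (- i)"])
    show "transpose i (- i) \<in> reflections_B k" "u \<circ> transpose i (- i) \<in> B k"
      using central u by (simp_all add: transpose_uminus_in_reflections_B B_compose transpose_uminus_in_B)
    show "rk ?S (u \<circ> transpose i (- i)) p q \<le> rk ?S v p q" for p q
      using le[of p q] central(5)[of p q] unfolding rk by (auto simp: of_bool_def)
    show "3 * (invs ?S (u \<circ> transpose i (- i)) - invs ?S u) +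
        (rk ?S (u \<circ> transpose i (- i)) 0 1 - rk ?S u 0 1) =
      2 * int (card {c \<in> {1..int k}. transpose i (- i) c \<noteq> c}) + 2"
      unfolding moved rk using invs_transpose_uminus(2)[OF u central(1-4)] central by simp
    show "invs ?S u < invs ?S (u \<circ> transpose i (- i))"
      by (rule invs_transpose_uminus(1)[OF u central(1-3)])
    fix c p q assume c: "c \<in> ?S" "transpose i (- i) c = c" "p = c \<or> p = c - 1" "q = u c \<or> q = u c + 1"
    have "c \<noteq> i" "c \<noteq> - i" using c central by (auto simp: transpose_def)
    moreover from this have "u c \<noteq> u i" "u c \<noteq> u (- i)" using B_inj[OF u] by auto
    ultimately show "rk ?S (u \<circ> transpose i (- i)) p q = rk ?S u p q"
      using c central(4) unfolding rk empty_rect_def by (auto simp: odd)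
  qed (simp add: rk)
next
  let ?S = "signed_interval k"
  note odd = B_odd[OF u]
  case (disjoint i j)
  have ne: "j \<noteq> i" "j \<noteq> - i" "i \<noteq> 0" "j \<noteq> 0" "u i \<noteq> 0" "u j \<noteq> 0"
    using disjoint B_mem[OF u, of i] B_mem[OF u, of j] by (auto simp: mem_signed_interval)
  let ?t = "signed_transpose i j"
  note rk = rk_signed_transpose[OF u disjoint(1-3) ne(2) disjoint(5)]
  have moved: "?t c \<noteq> c \<longleftrightarrow> c = i \<or> c = - i \<or> c = j \<or> c = - j" for c
    using ne by (auto simp: signed_transpose_def transpose_def)
  have "{c \<in> {1..int k}. ?t c \<noteq> c} = {\<bar>i\<bar>, \<bar>j\<bar>}"
    unfolding moved using disjoint(1,2) by (auto simp: mem_signed_interval)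
  then have card: "card {c \<in> {1..int k}. ?t c \<noteq> c} = 2" using ne by auto
  show ?thesis
  proof (rule that[of ?t])
    show "?t \<in> reflections_B k" "u \<circ> ?t \<in> B k"
      using disjoint ne u by (simp_all add: signed_transpose_in_reflections_B B_compose signed_transpose_in_B)
    show "rk ?S (u \<circ> ?t) p q \<le> rk ?S v p q" for p q
    proof -
      have "rk ?S u p q < rk ?S v p q" if "- j \<le> p" "p < - i" "- u j < q" "q \<le> - u i"
        using disjoint(8)[of "- p - 1" "1 - q"] that rk_uminus_less_iff[OF u v, of p q] by auto
      \<comment> \<open>By the sign condition the two half-open rectangles are disjoint, so each
        rank rises by at most 1, and only where \<open>u\<close> is strictly below
        \<open>v\<close>.\<close>
      moreover have "\<not> (i \<le> p \<and> p < j \<and> u i < q \<and> q \<le> u j \<and> - j \<le> p \<and> p < - i \<and> - u j < q \<and> q \<le> - u i)"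
        using disjoint(6) by auto
      ultimately show ?thesis
        using le[of p q] disjoint(8)[of p q] unfolding rk by (auto simp: of_bool_def)
    qed
    show "3 * (invs ?S (u \<circ> ?t) - invs ?S u) + (rk ?S (u \<circ> ?t) 0 1 - rk ?S u 0 1) =
      2 * int (card {c \<in> {1..int k}. ?t c \<noteq> c}) + 2"
      unfolding card rk
      using invs_signed_transpose_empty_rect[OF u disjoint(1-5,7,6)] disjoint(6) ne
      by (auto simp: of_bool_def)
    show "invs ?S u < invs ?S (u \<circ> ?t)"
      by (rule invs_signed_transpose_less[OF u disjoint(1-3) ne(2) disjoint(5)])
    fix c p q assume c: "c \<in> ?S" "?t c = c" "p = c \<or> p = c - 1" "q = u c \<or> q = u c + 1"
    have nc: "c \<noteq> i" "c \<noteq> - i" "c \<noteq> j" "c \<noteq> - j" using c moved[of c] by auto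
    have nu: "u c \<noteq> u i" "u c \<noteq> - u i" "u c \<noteq> u j" "u c \<noteq> - u j"
      using nc B_inj[OF u] odd by metis+
    \<comment> \<open>By emptiness neither the point at \<open>c\<close> nor its reflection is
      inside. A corner of its cell in one of the half-open rectangles would put it or its reflection
      inside, as \<open>c\<close> differs from all spanning positions.\<close>
    have "\<not> (i < c \<and> c < j \<and> u i < u c \<and> u c < u j)"
      "\<not> (i < - c \<and> - c < j \<and> u i < - u c \<and> - u c < u j)"
      using c(1) disjoint(7) uminus_mem_signed_interval odd unfolding empty_rect_def by metis+
    moreover have "i < c \<and> c < j" if "i \<le> p" "p < j" using that c(3) nc by auto
    moreover have "u i < u c \<and> u c < u j" if "u i < q" "q \<le> u j" using that c(4) nu by auto
    moreover have "i < - c \<and> - c < j" if "- j \<le> p" "p < - i" using that c(3) nc by auto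
    moreover have "u i < - u c \<and> - u c < u j" if "- u j < q" "q \<le> - u i" using that c(4) nu by auto
    ultimately have "\<not> (i \<le> p \<and> p < j \<and> u i < q \<and> q \<le> u j)"
      "\<not> (- j \<le> p \<and> p < - i \<and> - u j < q \<and> q \<le> - u i)"
      by blast+
    then show "rk ?S (u \<circ> ?t) p q = rk ?S u p q" unfolding rk by simp
  qed (simp add: rk)
qed

text \<open>Normalise the reflection to \<open>0 < i\<close> or \<open>i < j\<close>. Either it
  creates inversions in \<open>u\<close> and the ranks rise, or the same reflection leads up from
  \<open>w\<close> to \<open>u\<close>, contradicting the lengths.\<close>

lemma bruhat_step_rk_le:
  assumes "bruhat_step k u w"
  shows "w \<in> B k \<and> rk (signed_interval k) u p q \<le> rk (signed_interval k) w p q"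
proof -
  let ?S = "signed_interval k"
  from assms obtain t where u: "u \<in> B k" and t: "t \<in> reflections_B k" and w: "w = u \<circ> t"
    and len: "length_B k u < length_B k w"
    by (auto simp: bruhat_step_def)
  have "k \<ge> 1"
  proof (rule ccontr)
    assume "\<not> k \<ge> 1"
    then have empty: "{(a, b). 1 \<le> a \<and> a < b \<and> b \<le> int k \<and> Q a b} = {}" for Q by auto
    have "length_B k w = 0" using \<open>\<not> k \<ge> 1\<close>
      unfolding length_B_def inv_B_def neg_B_def nsp_B_def empty by simp
    then show False using len by simp
  qed
  have not_down: False if "w \<in> B k" "invs ?S w < invs ?S u" "rk ?S w 0 1 \<le> rk ?S u 0 1"
    using u that len length_B_eq[of u k] length_B_eq[of w k] by auto
  from t \<open>k \<ge> 1\<close> show ?thesis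
  proof (cases rule: reflections_B_cases)
    case (1 i')
    define i where "i = \<bar>i'\<bar>"
    have i: "i \<in> ?S" "0 < i" using 1 by (auto simp: i_def mem_signed_interval)
    have ti: "t = transpose i (- i)" using 1 by (auto simp: i_def abs_if transpose_commute)
    have wB: "w \<in> B k" using w u i ti by (simp add: B_compose transpose_uminus_in_B)
    have "u i \<noteq> 0" using B_mem[OF u, of i] i by (auto simp: mem_signed_interval)
    moreover have "\<not> u i < 0"
    proof
      assume "u i < 0"
      then have wi: "0 < w i" using w ti B_odd[OF u] by simp
      have uw: "u = w \<circ> transpose i (- i)" by (simp add: w ti comp_assoc)
      show False
        using not_down[OF wB] invs_transpose_uminus(1)[OF wB i wi]
          rk_transpose_uminus[OF wB i wi, of 0 1] uw by simp
    qed
    ultimately have "0 < u i" by simp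
    then show ?thesis using rk_transpose_uminus[OF u i] wB w ti by simp
  next
    case (2 i' j')
    define i where "i = min i' j'"
    define j where "j = max i' j'"
    have ij: "i \<in> ?S" "j \<in> ?S" "i < j" "j \<noteq> - i" using 2 by (auto simp: i_def j_def min_def max_def)
    have tt: "t = signed_transpose i j"
      using 2 by (auto simp: i_def j_def min_def max_def signed_transpose_def transpose_commute)
    have wB: "w \<in> B k" using w u ij tt by (simp add: B_compose signed_transpose_in_B)
    have "u i \<noteq> u j" using B_inj[OF u] ij by simp
    moreover have "\<not> u j < u i"
    proof
      assume "u j < u i"
      moreover have "t i = j" "t j = i" using ij
        by (auto simp: tt signed_transpose_def transpose_def mem_signed_interval)
      ultimately have wi: "w i < w j" by (simp add: w)
      have "t \<circ> t = id" using ij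
        by (auto simp: fun_eq_iff tt signed_transpose_def transpose_def mem_signed_interval)
      then have uw: "u = w \<circ> signed_transpose i j" by (simp add: w tt comp_assoc)
      show False
        using not_down[OF wB] invs_signed_transpose_less[OF wB ij wi]
          rk_signed_transpose[OF wB ij wi, of 0 1] uw by simp
    qed
    ultimately have "u i < u j" by simp
    then show ?thesis using rk_signed_transpose[OF u ij] wB w tt by simp
  qed
qed

lemma bruhat_le_imp_rk_le:
  assumes "bruhat_le k u w" "u \<in> B k"
  shows "w \<in> B k \<and> rk (signed_interval k) u p q \<le> rk (signed_interval k) w p q"
  using assms(1) unfolding bruhat_le_def
proof (induction rule: rtranclp_induct)
  case base
  then show ?case using assms(2) by simp
next
  case (step y z)
  then show ?case using bruhat_step_rk_le[OF step(2), of p q] by linarith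
qed

lemma invs_le: "invs S w \<le> int (card S) * int (card S)"
proof -
  have "invs S w \<le> (\<Sum>a\<in>S. \<Sum>b\<in>S. 1)" unfolding invs_def by (intro sum_mono) simp
  then show ?thesis by simp
qed

text \<open>Climb from \<open>u\<close> by covers that stay below \<open>v\<close>. Each raises
  \<open>invs\<close>, which is bounded by the square of the number of positions.\<close>

lemma rk_le_imp_bruhat_le:
  assumes "u \<in> B k" "v \<in> B k" "\<And>p q. rk (signed_interval k) u p q \<le> rk (signed_interval k) v p q"
  shows "bruhat_le k u v"
  using assms(1,3)
proof (induction "nat (int (card (signed_interval k)) * int (card (signed_interval k)) - invs (signed_interval k) u)"
    arbitrary: u rule: less_induct)
  case less
  let ?S = "signed_interval k"
  show ?case
  proof (cases "u = v")
    case True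
    then show ?thesis by (simp add: bruhat_le_def)
  next
    case False
    from less.prems(1) assms(2) False less.prems(2)
    obtain t where t: "t \<in> reflections_B k" "u \<circ> t \<in> B k" "\<And>p q. rk ?S u p q \<le> rk ?S (u \<circ> t) p q"
      "\<And>p q. rk ?S (u \<circ> t) p q \<le> rk ?S v p q" "invs ?S u < invs ?S (u \<circ> t)"
      by (rule exists_bruhat_cover_below) (rule that)
    have "length_B k u < length_B k (u \<circ> t)"
      using length_B_eq[OF less.prems(1)] length_B_eq[OF t(2)] t(3)[of 0 1] t(5) by simp
    then have "bruhat_step k u (u \<circ> t)" using less.prems(1) t(1) unfolding bruhat_step_def by blast
    moreover have "bruhat_le k (u \<circ> t) v"
      using less.hyps[OF _ t(2,4)] t(5) invs_le[of ?S "u \<circ> t"] by simp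
    ultimately show ?thesis by (simp add: bruhat_le_def converse_rtranclp_into_rtranclp)
  qed
qed

lemma bruhat_le_iff_rk_le:
  assumes "u \<in> B k" "v \<in> B k"
  shows "bruhat_le k u v \<longleftrightarrow> (\<forall>p q. rk (signed_interval k) u p q \<le> rk (signed_interval k) v p q)"
  using assms bruhat_le_imp_rk_le rk_le_imp_bruhat_le by blast

lemma bruhat_le_length_less:
  assumes "bruhat_le k u v" "u \<noteq> v"
  shows "length_B k u < length_B k v"
  using assms unfolding bruhat_le_def
proof (induction rule: rtranclp_induct)
  case (step y z)
  then have "length_B k y < length_B k z" by (simp add: bruhat_step_def)
  then show ?case using step.IH by (cases "u = y") auto
qed simp

section \<open>Block permutations\<close>

text \<open>Block \<open>I\<close> is \<open>{2 * I - 1, 2 * I}\<close> for positive and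
  \<open>{2 * I, 2 * I + 1}\<close> for negative \<open>I\<close>. With this choice negation carries
  block \<open>I\<close> to block \<open>- I\<close> and exchanges lower and upper elements.\<close>

definition lo :: "int \<Rightarrow> int" where "lo I = (if I > 0 then 2 * I - 1 else 2 * I)"

definition hi :: "int \<Rightarrow> int" where "hi I = lo I + 1"

definition blk :: "int \<Rightarrow> int" where "blk x = (if x > 0 then (x + 1) div 2 else x div 2)"

lemma blk_lo [simp]: "I \<noteq> 0 \<Longrightarrow> blk (lo I) = I"
  by (auto simp: blk_def lo_def)

lemma blk_hi [simp]: "I \<noteq> 0 \<Longrightarrow> blk (hi I) = I"
  by (auto simp: blk_def hi_def lo_def)

lemma lo_or_hi: "x \<noteq> 0 \<Longrightarrow> x = lo (blk x) \<or> x = hi (blk x)"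
  by (cases "even x") (auto simp: blk_def hi_def lo_def elim!: evenE oddE)

lemma lo_neq_hi_same [simp]: "lo I \<noteq> hi I" "hi I \<noteq> lo I"
  by (simp_all add: hi_def)

lemma lo_neq_hi: "I \<noteq> 0 \<Longrightarrow> J \<noteq> 0 \<Longrightarrow> lo I \<noteq> hi J"
  by (metis blk_lo blk_hi lo_neq_hi_same(1))

lemma lo_inj: "I \<noteq> 0 \<Longrightarrow> J \<noteq> 0 \<Longrightarrow> lo I = lo J \<longleftrightarrow> I = J"
  by (metis blk_lo)

lemma hi_inj: "I \<noteq> 0 \<Longrightarrow> J \<noteq> 0 \<Longrightarrow> hi I = hi J \<longleftrightarrow> I = J"
  by (metis blk_hi)

lemma lo_uminus: "I \<noteq> 0 \<Longrightarrow> lo (- I) = - hi I"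
  and hi_uminus: "I \<noteq> 0 \<Longrightarrow> hi (- I) = - lo I"
  by (auto simp: hi_def lo_def)

lemma blk_uminus: "x \<noteq> 0 \<Longrightarrow> blk (- x) = - blk x"
  by (cases "even x") (auto simp: blk_def elim!: evenE oddE)

lemma lo_mem: "lo I \<in> signed_interval (2 * m) \<longleftrightarrow> I \<in> signed_interval m"
  and hi_mem: "I \<noteq> 0 \<Longrightarrow> hi I \<in> signed_interval (2 * m) \<longleftrightarrow> I \<in> signed_interval m"
  by (auto simp: lo_def hi_def mem_signed_interval)

lemma blk_mem: "x \<in> signed_interval (2 * m) \<Longrightarrow> blk x \<in> signed_interval m"
  unfolding blk_def mem_signed_interval by auto

lemma signed_interval_ne_0: "x \<in> signed_interval k \<Longrightarrow> x \<noteq> 0"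
  by (simp add: mem_signed_interval)

lemma hi_less_lo: "I \<noteq> 0 \<Longrightarrow> J \<noteq> 0 \<Longrightarrow> I < J \<Longrightarrow> hi I < lo J"
  by (auto simp: lo_def hi_def)

lemma sum_signed_interval_double:
  "(\<Sum>c\<in>signed_interval (2 * m). f c :: 'a::comm_monoid_add) = (\<Sum>I\<in>signed_interval m. f (lo I) + f (hi I))"
proof -
  let ?S = "signed_interval m"
  have "signed_interval (2 * m) = lo ` ?S \<union> hi ` ?S"
  proof
    show "signed_interval (2 * m) \<subseteq> lo ` ?S \<union> hi ` ?S"
      using lo_or_hi blk_mem signed_interval_ne_0 by blast
  qed (auto simp: lo_mem hi_mem signed_interval_ne_0)
  moreover have "lo ` ?S \<inter> hi ` ?S = {}" by (auto simp: lo_neq_hi signed_interval_ne_0)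
  ultimately have "sum f (signed_interval (2 * m)) = sum f (lo ` ?S) + sum f (hi ` ?S)"
    by (simp add: sum.union_disjoint)
  also have "sum f (lo ` ?S) = (\<Sum>I\<in>?S. f (lo I))"
    by (subst sum.reindex) (auto simp: inj_on_def lo_inj signed_interval_ne_0)
  also have "sum f (hi ` ?S) = (\<Sum>I\<in>?S. f (hi I))"
    by (subst sum.reindex) (auto simp: inj_on_def hi_inj signed_interval_ne_0)
  finally show ?thesis by (simp add: sum.distrib)
qed

section \<open>The coordinates \<open>(\<sigma>, T)\<close> of a block permutation\<close>

text \<open>Negation reverses positions and values at once, so a block and its negative share their
  orientation, and the sign cases of the definition disappear.\<close>

lemma represents_lo_hi:
  assumes "represents m v \<sigma> T" "I \<in> signed_interval m"
  shows "v (lo I) = (if \<bar>I\<bar> \<in> T then hi (\<sigma> I) else lo (\<sigma> I))"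
    and "v (hi I) = (if \<bar>I\<bar> \<in> T then lo (\<sigma> I) else hi (\<sigma> I))"
proof -
  have v: "v \<in> B (2 * m)" and s: "\<sigma> \<in> B m" using assms(1) by (auto simp: represents_def)
  have ne: "\<sigma> I \<noteq> 0" if "I \<in> signed_interval m" for I
    using B_mem[OF s, of I] that by (auto simp: mem_signed_interval)
  have pos: "v (lo i) = (if i \<in> T then hi (\<sigma> i) else lo (\<sigma> i)) \<and>
      v (hi i) = (if i \<in> T then lo (\<sigma> i) else hi (\<sigma> i))" if "i \<in> {1..int m}" for i
  proof -
    have "\<sigma> i \<noteq> 0" using ne that by (simp add: mem_signed_interval)
    moreover have "lo i = 2 * i - 1" "hi i = 2 * i" using that by (auto simp: lo_def hi_def)
    ultimately show ?thesis using assms(1) that unfolding represents_def by (auto simp: lo_def hi_def)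
  qed
  have "v (lo I) = (if \<bar>I\<bar> \<in> T then hi (\<sigma> I) else lo (\<sigma> I)) \<and>
      v (hi I) = (if \<bar>I\<bar> \<in> T then lo (\<sigma> I) else hi (\<sigma> I))"
  proof (cases "0 < I")
    case True
    then show ?thesis using pos[of I] assms(2) by (simp add: mem_signed_interval)
  next
    case False
    then obtain i where i: "I = - i" "i \<in> {1..int m}"
      using assms(2) by (intro that[of "- I"]) (auto simp: mem_signed_interval)
    moreover have "\<sigma> i \<noteq> 0" "i \<noteq> 0" using ne i by (auto simp: mem_signed_interval)
    ultimately show ?thesis
      using pos[OF i(2)] by (simp add: lo_uminus hi_uminus B_odd[OF v] B_odd[OF s])
  qed
  then show "v (lo I) = (if \<bar>I\<bar> \<in> T then hi (\<sigma> I) else lo (\<sigma> I))"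
    "v (hi I) = (if \<bar>I\<bar> \<in> T then lo (\<sigma> I) else hi (\<sigma> I))" by blast+
qed

lemma represents_I:
  assumes v: "v \<in> B (2 * m)" and s: "\<sigma> \<in> B m" and "T \<subseteq> {1..int m}"
    and lh: "\<And>i. i \<in> {1..int m} \<Longrightarrow> v (lo i) = (if i \<in> T then hi (\<sigma> i) else lo (\<sigma> i)) \<and>
      v (hi i) = (if i \<in> T then lo (\<sigma> i) else hi (\<sigma> i))"
  shows "represents m v \<sigma> T"
  unfolding represents_def
proof (intro conjI ballI assms(1-3))
  fix i assume i: "i \<in> {1..int m}"
  have "\<sigma> i \<noteq> 0" using B_mem[OF s, of i] i by (auto simp: mem_signed_interval)
  moreover have "lo i = 2 * i - 1" "hi i = 2 * i" using i by (auto simp: lo_def hi_def)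
  ultimately show "i \<notin> T \<longrightarrow> v (2 * i - 1) = 2 * \<sigma> i - of_bool (0 < \<sigma> i) \<and> v (2 * i) = 2 * \<sigma> i + of_bool (\<sigma> i < 0)"
    "i \<in> T \<longrightarrow> v (2 * i - 1) = 2 * \<sigma> i + of_bool (\<sigma> i < 0) \<and> v (2 * i) = 2 * \<sigma> i - of_bool (0 < \<sigma> i)"
    using lh[OF i] by (auto simp: lo_def hi_def)
qed

lemma represents_in_B:
  assumes "represents m v \<sigma> T"
  shows "v \<in> B (2 * m)" "\<sigma> \<in> B m" "T \<subseteq> {1..int m}"
  using assms by (auto simp: represents_def)

lemma B_eqI:
  assumes "u \<in> B k" "v \<in> B k" "\<And>x. x \<in> signed_interval k \<Longrightarrow> u x = v x"
  shows "u = v"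
proof
  fix x show "u x = v x"
    using assms(3)[of x] permutes_not_in[OF B_permutes[OF assms(1)], of x]
      permutes_not_in[OF B_permutes[OF assms(2)], of x] by (cases "x \<in> signed_interval k") auto
qed

lemma represents_fun_unique:
  assumes "represents m u \<sigma> T" "represents m v \<sigma> T"
  shows "u = v"
proof (rule B_eqI[OF represents_in_B(1)[OF assms(1)] represents_in_B(1)[OF assms(2)]])
  fix x assume x: "x \<in> signed_interval (2 * m)"
  then obtain I where I: "I \<in> signed_interval m" "x = lo I \<or> x = hi I"
    using lo_or_hi signed_interval_ne_0 blk_mem by blast
  then show "u x = v x"
    using represents_lo_hi[OF assms(1) I(1)] represents_lo_hi[OF assms(2) I(1)] by auto
qed

lemma represents_sigma:
  assumes "represents m v \<sigma> T" "I \<in> signed_interval m"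
  shows "\<sigma> I = blk (v (lo I))"
proof -
  have "\<sigma> I \<noteq> 0" using B_mem[OF represents_in_B(2)[OF assms(1)]] assms(2) signed_interval_ne_0 by metis
  then show ?thesis using represents_lo_hi[OF assms] by simp
qed

lemma sigma_part_eq:
  assumes "represents m v \<sigma> T"
  shows "sigma_part m v = \<sigma>"
  unfolding sigma_part_def
proof (rule the_equality)
  show "\<exists>T. represents m v \<sigma> T" using assms by blast
  fix \<tau> assume "\<exists>T. represents m v \<tau> T"
  then obtain S where S: "represents m v \<tau> S" by blast
  show "\<tau> = \<sigma>"
    by (rule B_eqI[OF represents_in_B(2)[OF S] represents_in_B(2)[OF assms]])
      (simp add: represents_sigma[OF S] represents_sigma[OF assms])
qed

lemma B_inv_apply: "v \<in> B k \<Longrightarrow> inv v (v x) = x"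
  by (rule permutes_inverses(2)[OF B_permutes])

lemma represents_in_W_B:
  assumes "represents m v \<sigma> T"
  shows "v \<in> W_B (2 * m)"
  unfolding W_B_def
proof (intro CollectI conjI ballI)
  show v: "v \<in> B (2 * m)" using represents_in_B[OF assms] by simp
  have s: "\<sigma> \<in> B m" using represents_in_B[OF assms] by simp
  fix a assume a: "a \<in> {1..int (2 * m) - 1}"
  define J where "J = blk a"
  \<comment> \<open>\<open>star\<close> pairs the two elements of a block, and these occupy the two
    positions of a single block.\<close>
  have star: "a = lo J \<and> star (2 * m) a = hi J \<or> a = hi J \<and> star (2 * m) a = lo J"
    using a by (cases "even a") (auto simp: J_def star_def blk_def lo_def hi_def elim!: evenE oddE)
  obtain I where I: "\<sigma> I = J" using B_surj[OF s] .
  have "J \<in> signed_interval m" using a unfolding J_def by (intro blk_mem) (simp add: mem_signed_interval)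
  then have "I \<in> signed_interval m" using I B_mem[OF s, of I] by simp
  note lh = represents_lo_hi[OF assms this, unfolded I]
  have "\<bar>inv v (lo J) - inv v (hi J)\<bar> = 1"
    using lh B_inv_apply[OF v, of "lo I"] B_inv_apply[OF v, of "hi I"]
    by (auto simp: hi_def split: if_splits)
  then show "\<bar>inv v a - inv v (star (2 * m) a)\<bar> \<le> 1"
    using star by auto
qed

lemma W_B_adjacent:
  assumes "v \<in> W_B (2 * m)" "J \<in> signed_interval m"
  shows "\<bar>inv v (lo J) - inv v (hi J)\<bar> \<le> 1"
proof -
  have v: "v \<in> B (2 * m)" using assms by (simp add: W_B_def)
  have pos: "\<bar>inv v (lo j) - inv v (hi j)\<bar> \<le> 1" if "0 < j" "j \<le> int m" for j
  proof -
    have "lo j \<in> {1..int (2 * m) - 1}" "star (2 * m) (lo j) = hi j"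
      using that by (auto simp: lo_def hi_def star_def)
    then show ?thesis using assms(1) unfolding W_B_def by force
  qed
  have odd: "inv v (- x) = - inv v x" for x
    using B_odd[OF v] B_inv_apply[OF v] B_surj[OF v] by metis
  show ?thesis
  proof (cases "0 < J")
    case True
    then show ?thesis using pos assms(2) by (simp add: mem_signed_interval)
  next
    case False
    then have "\<bar>inv v (lo (- J)) - inv v (hi (- J))\<bar> \<le> 1" "J \<noteq> 0"
      using pos[of "- J"] assms(2) by (auto simp: mem_signed_interval)
    then show ?thesis by (simp add: lo_uminus hi_uminus odd)
  qed
qed

text \<open>Induction over blocks from the origin outwards. The partner of the value at the lower
  position sits next to it. Were it on the left, it would lie in the preceding block, which by
  induction already holds a full block of values.\<close>

lemma W_B_block_image:
  assumes "v \<in> W_B (2 * m)" "I \<in> signed_interval m"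
  shows "blk (v (hi I)) = blk (v (lo I))"
proof -
  have v: "v \<in> B (2 * m)" using assms by (simp add: W_B_def)
  have "int i \<le> int m \<Longrightarrow> i \<ge> 1 \<Longrightarrow> blk (v (hi (int i))) = blk (v (lo (int i)))" for i :: nat
  proof (induction i)
    case (Suc i)
    define y where "y = v (lo (int (Suc i)))"
    define J where "J = blk y"
    define y' where "y' = (if y = lo J then hi J else lo J)"
    have "int (Suc i) \<in> signed_interval m" using Suc.prems by (simp add: mem_signed_interval)
    then have mem: "lo (int (Suc i)) \<in> signed_interval (2 * m)" by (simp only: lo_mem)
    then have yS: "y \<in> signed_interval (2 * m)" using B_mem[OF v] unfolding y_def by blast
    then have J: "J \<in> signed_interval m" "J \<noteq> 0" unfolding J_def by (auto dest: blk_mem signed_interval_ne_0)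
    have yy: "y = lo J \<or> y = hi J" using lo_or_hi[OF signed_interval_ne_0[OF yS]] unfolding J_def .
    then have y'J: "blk y' = J" "y' \<noteq> y" unfolding y'_def using J by auto
    have y'S: "y' \<in> signed_interval (2 * m)" unfolding y'_def using J by (simp add: lo_mem hi_mem)
    obtain x where x: "v x = y'" using B_surj[OF v] .
    have xS: "x \<in> signed_interval (2 * m)" using x y'S B_mem[OF v, of x] by simp
    have "\<bar>inv v y - inv v y'\<bar> \<le> 1" using W_B_adjacent[OF assms(1) J(1)] yy unfolding y'_def by auto
    then have "\<bar>lo (int (Suc i)) - x\<bar> \<le> 1" using B_inv_apply[OF v] unfolding y_def x[symmetric] by simp
    moreover have "x \<noteq> lo (int (Suc i))" using x y'J y_def by auto
    \<comment> \<open>To the left of the first block is 0, which is not a position, so this case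
      always has a preceding block.\<close>
    moreover have "x \<noteq> lo (int (Suc i)) - 1"
    proof
      assume xe: "x = lo (int (Suc i)) - 1"
      then have i: "i \<ge> 1" and xi: "x = hi (int i)"
        using signed_interval_ne_0[OF xS] by (auto simp: lo_def hi_def split: if_splits)
      define z where "z = v (lo (int i))"
      have "blk z = J" using Suc.IH Suc.prems i x xi y'J unfolding z_def by simp
      moreover have "int i \<in> signed_interval m" using Suc.prems i by (simp add: mem_signed_interval)
      then have "z \<in> signed_interval (2 * m)" using B_mem[OF v] unfolding z_def by (simp add: lo_mem)
      ultimately have "z = lo J \<or> z = hi J" using lo_or_hi signed_interval_ne_0 by metis
      then have "z = y \<or> z = y'" using yy unfolding y'_def by auto
      then have "lo (int i) = lo (int (Suc i)) \<or> lo (int i) = hi (int i)"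
        using B_inj[OF v] x xi unfolding z_def y_def by metis
      then show False using i by (auto simp: lo_def hi_def)
    qed
    ultimately have "x = hi (int (Suc i))" by (auto simp: hi_def)
    then show ?case using x y'J unfolding J_def y_def by simp
  qed simp
  note pos = this
  show ?thesis
  proof (cases "0 < I")
    case True
    then show ?thesis using pos[of "nat I"] assms(2) by (simp add: mem_signed_interval)
  next
    case False
    then have I: "I < 0" "- I \<in> signed_interval m" using assms(2) by (auto simp: mem_signed_interval)
    have "v (lo (- I)) \<noteq> 0" "v (hi (- I)) \<noteq> 0"
      using I B_mem[OF v] by (metis lo_mem hi_mem signed_interval_ne_0)+
    then show ?thesis
      using pos[of "nat (- I)"] I blk_uminus B_odd[OF v]
      by (simp add: mem_signed_interval lo_uminus hi_uminus blk_uminus B_odd[OF v])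
  qed
qed

lemma W_B_represents:
  assumes "v \<in> W_B (2 * m)"
  obtains \<sigma> T where "represents m v \<sigma> T"
proof -
  let ?S = "signed_interval m"
  have v: "v \<in> B (2 * m)" using assms by (simp add: W_B_def)
  define \<sigma> where "\<sigma> I = (if I \<in> ?S then blk (v (lo I)) else I)" for I
  have vS: "v (lo I) \<in> signed_interval (2 * m)" "v (hi I) \<in> signed_interval (2 * m)" if "I \<in> ?S" for I
    using that B_mem[OF v] by (auto simp: lo_mem hi_mem signed_interval_ne_0)
  have blocks: "v (lo I) = lo (\<sigma> I) \<and> v (hi I) = hi (\<sigma> I) \<or> v (lo I) = hi (\<sigma> I) \<and> v (hi I) = lo (\<sigma> I)"
    if "I \<in> ?S" for I
  proof -
    have "blk (v (lo I)) = \<sigma> I" "blk (v (hi I)) = \<sigma> I"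
      using W_B_block_image[OF assms that] that by (simp_all add: \<sigma>_def)
    moreover have "v (lo I) \<noteq> v (hi I)" using B_inj[OF v] signed_interval_ne_0[OF that] by simp
    ultimately show ?thesis
      using lo_or_hi[OF signed_interval_ne_0[OF vS(1)[OF that]]]
        lo_or_hi[OF signed_interval_ne_0[OF vS(2)[OF that]]] by auto
  qed
  have maps: "\<sigma> I \<in> ?S" if "I \<in> ?S" for I using vS[OF that] that by (simp add: \<sigma>_def blk_mem)
  have "inj_on \<sigma> ?S"
  proof
    fix I J assume IJ: "I \<in> ?S" "J \<in> ?S" "\<sigma> I = \<sigma> J"
    then have "v (lo I) = v (lo J) \<or> v (lo I) = v (hi J)" using blocks[OF IJ(1)] blocks[OF IJ(2)] by auto
    then show "I = J" using IJ B_inj[OF v] by (auto simp: lo_inj lo_neq_hi signed_interval_ne_0)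
  qed
  moreover have "\<sigma> ` ?S \<subseteq> ?S" using maps by blast
  ultimately have "bij_betw \<sigma> ?S ?S" by (simp add: bij_betw_def endo_inj_surj)
  then have "\<sigma> permutes ?S" by (rule bij_imp_permutes) (simp add: \<sigma>_def)
  moreover have "\<sigma> (- I) = - \<sigma> I" for I
  proof (cases "I \<in> ?S")
    case True
    then show ?thesis
      using W_B_block_image[OF assms True] signed_interval_ne_0[OF vS(2)[OF True]]
      by (simp add: \<sigma>_def lo_uminus signed_interval_ne_0 B_odd[OF v] blk_uminus)
  qed (simp add: \<sigma>_def)
  ultimately have s: "\<sigma> \<in> B m" by (rule B_I)
  have "represents m v \<sigma> {i \<in> {1..int m}. v (lo i) = hi (\<sigma> i)}"
  proof (rule represents_I[OF v s])
    fix i assume i: "i \<in> {1..int m}"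
    then have "i \<in> ?S" by (simp add: mem_signed_interval)
    then show "v (lo i) = (if i \<in> {i \<in> {1..int m}. v (lo i) = hi (\<sigma> i)} then hi (\<sigma> i) else lo (\<sigma> i)) \<and>
      v (hi i) = (if i \<in> {i \<in> {1..int m}. v (lo i) = hi (\<sigma> i)} then lo (\<sigma> i) else hi (\<sigma> i))"
      using blocks[of i] maps[of i] signed_interval_ne_0 i by auto
  qed auto
  then show ?thesis using that by blast
qed

lemma exists_represents:
  assumes s: "\<sigma> \<in> B m" and T: "T \<subseteq> {1..int m}"
  obtains v where "represents m v \<sigma> T"
proof -
  let ?S = "signed_interval (2 * m)"
  define low where "low x \<longleftrightarrow> x = lo (blk x)" for x
  \<comment> \<open>Comparing the two truth values puts position and value at the same end of their
    blocks exactly outside \<open>T\<close>.\<close>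
  define v where "v x = (if x \<in> ?S then
    if low x = (\<bar>blk x\<bar> \<notin> T) then lo (\<sigma> (blk x)) else hi (\<sigma> (blk x)) else x)" for x
  have low: "low (lo I)" "\<not> low (hi I)" if "I \<noteq> 0" for I using that by (simp_all add: low_def)
  have ne: "\<sigma> (blk x) \<in> signed_interval m" "\<sigma> (blk x) \<noteq> 0" "blk x \<noteq> 0" "x \<noteq> 0" if "x \<in> ?S" for x
  proof -
    show "\<sigma> (blk x) \<in> signed_interval m" using s blk_mem[OF that] by simp
    then show "\<sigma> (blk x) \<noteq> 0" by (rule signed_interval_ne_0)
    show "blk x \<noteq> 0" "x \<noteq> 0" using blk_mem[OF that] that by (blast dest: signed_interval_ne_0)+
  qed
  have blkv: "blk (v x) = \<sigma> (blk x)" if "x \<in> ?S" for x using ne[OF that] that by (simp add: v_def)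
  have "inj_on v ?S"
  proof
    fix x y assume xy: "x \<in> ?S" "y \<in> ?S" "v x = v y"
    then have "\<sigma> (blk x) = \<sigma> (blk y)" using blkv by metis
    then have b: "blk x = blk y" using B_inj[OF s] by simp
    have "low x = low y"
      using xy unfolding v_def b by (simp split: if_splits)
    then show "x = y" using lo_or_hi[of x] lo_or_hi[of y] ne[OF xy(1)] ne[OF xy(2)] b
      unfolding low_def by argo
  qed
  moreover have "v ` ?S \<subseteq> ?S" using ne by (auto simp: v_def lo_mem hi_mem)
  ultimately have "bij_betw v ?S ?S" by (simp add: bij_betw_def endo_inj_surj)
  then have "v permutes ?S" by (rule bij_imp_permutes) (simp add: v_def)
  moreover have "v (- x) = - v x" for x
  proof (cases "x \<in> ?S")
    case True
    have "x = lo (blk x) \<or> x = hi (blk x)" using lo_or_hi ne[OF True] by simp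
    then have "low (- x) \<longleftrightarrow> \<not> low x"
    proof
      assume x: "x = lo (blk x)"
      then have "low x" by (simp add: low_def)
      moreover have "- x = hi (- blk x)" using x ne[OF True] by (simp add: hi_uminus)
      then have "\<not> low (- x)" using low(2)[of "- blk x"] ne[OF True] by simp
      ultimately show ?thesis by simp
    next
      assume x: "x = hi (blk x)"
      then have "\<not> low x" using low(2)[of "blk x"] ne[OF True] by simp
      moreover have "- x = lo (- blk x)" using x ne[OF True] by (simp add: lo_uminus)
      then have "low (- x)" using low(1)[of "- blk x"] ne[OF True] by simp
      ultimately show ?thesis by simp
    qed
    then show ?thesis using True ne[OF True]
      by (simp add: v_def blk_uminus B_odd[OF s] lo_uminus hi_uminus)
  qed (simp add: v_def)
  ultimately have "v \<in> B (2 * m)" by (rule B_I)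
  then have "represents m v \<sigma> T"
  proof (rule represents_I[OF _ s T])
    fix i assume i: "i \<in> {1..int m}"
    then have "i \<in> signed_interval m" "i \<noteq> 0" "\<bar>i\<bar> = i" by (simp_all add: mem_signed_interval)
    moreover from this have "lo i \<in> ?S" "hi i \<in> ?S" by (simp_all only: lo_mem hi_mem not_False_eq_True)
    ultimately show "v (lo i) = (if i \<in> T then hi (\<sigma> i) else lo (\<sigma> i)) \<and>
      v (hi i) = (if i \<in> T then lo (\<sigma> i) else hi (\<sigma> i))" unfolding v_def by (simp add: low)
  qed
  then show ?thesis using that by blast
qed

section \<open>The induced order on block permutations\<close>

lemma lo_less_hi: "lo I < hi I"
  by (simp add: hi_def)

text \<open>A cut at \<open>p\<close> induces one cut on lower elements and one on upper elements.
  They differ only when \<open>p\<close> is itself a lower element, so that its block is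
  split.\<close>

lemma position_cuts:
  obtains a b where "\<And>I. I \<noteq> 0 \<Longrightarrow> lo I \<le> p \<longleftrightarrow> I \<le> a" "\<And>I. I \<noteq> 0 \<Longrightarrow> hi I \<le> p \<longleftrightarrow> I \<le> b"
    "b = a \<or> b = a - 1"
proof (cases "0 \<le> p")
  case True
  show ?thesis
    by (rule that[of "(p + 1) div 2" "p div 2"]) (use True in \<open>auto simp: lo_def hi_def\<close>)
next
  case False
  show ?thesis
    by (rule that[of "p div 2" "(p - 1) div 2"]) (use False in \<open>auto simp: lo_def hi_def\<close>)
qed

lemma value_cuts:
  obtains c d where "\<And>J. J \<noteq> 0 \<Longrightarrow> q \<le> hi J \<longleftrightarrow> c \<le> J" "\<And>J. J \<noteq> 0 \<Longrightarrow> q \<le> lo J \<longleftrightarrow> d \<le> J"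
    "d = c \<or> d = c + 1"
proof -
  obtain a b where ab: "\<And>I. I \<noteq> 0 \<Longrightarrow> lo I \<le> - q \<longleftrightarrow> I \<le> a" "\<And>I. I \<noteq> 0 \<Longrightarrow> hi I \<le> - q \<longleftrightarrow> I \<le> b"
    "b = a \<or> b = a - 1"
    by (rule position_cuts[of "- q"]) (rule that)
  show ?thesis
  proof (rule that[of "- a" "- b"])
    fix J :: int assume J: "J \<noteq> 0"
    show "q \<le> hi J \<longleftrightarrow> - a \<le> J" "q \<le> lo J \<longleftrightarrow> - b \<le> J"
      using ab(1,2)[of "- J"] J by (auto simp: lo_uminus hi_uminus)
  qed (use ab(3) in auto)
qed

text \<open>A block split in at most one direction contributes half the sum over the four pairs of
  cuts. If it is split in both, only one pair of cuts counts it, while the true contribution is 1 or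
  0 according to its orientation; hence the sign.\<close>

lemma block_rank_identity:
  fixes I J a b c d :: int
  assumes "b = a \<or> b = a - 1" "d = c \<or> d = c + 1"
  shows "2 * (of_bool (I \<le> a \<and> (if t then c \<le> J else d \<le> J)) +
      of_bool (I \<le> b \<and> (if t then d \<le> J else c \<le> J))) =
    of_bool (I \<le> a \<and> c \<le> J) + of_bool (I \<le> b \<and> c \<le> J) + of_bool (I \<le> a \<and> d \<le> J) +
    of_bool (I \<le> b \<and> d \<le> J) +
    (if I = a \<and> b \<noteq> a \<and> d \<noteq> c \<and> J = c then if t then 1 else - 1 else (0 :: int))"
  using assms
  by (elim disjE; cases "I < a"; cases "I = a"; cases "c < J"; cases "J = c"; cases t) simp_all

lemma rk_represents:
  assumes rep: "represents m v \<sigma> T"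
    and a: "\<And>I. I \<noteq> 0 \<Longrightarrow> lo I \<le> p \<longleftrightarrow> I \<le> a" and b: "\<And>I. I \<noteq> 0 \<Longrightarrow> hi I \<le> p \<longleftrightarrow> I \<le> b"
    and ab: "b = a \<or> b = a - 1"
    and c: "\<And>J. J \<noteq> 0 \<Longrightarrow> q \<le> hi J \<longleftrightarrow> c \<le> J" and d: "\<And>J. J \<noteq> 0 \<Longrightarrow> q \<le> lo J \<longleftrightarrow> d \<le> J"
    and cd: "d = c \<or> d = c + 1"
  shows "2 * rk (signed_interval (2 * m)) v p q =
    rk (signed_interval m) \<sigma> a c + rk (signed_interval m) \<sigma> b c +
    rk (signed_interval m) \<sigma> a d + rk (signed_interval m) \<sigma> b d +
    (if b \<noteq> a \<and> d \<noteq> c \<and> a \<in> signed_interval m \<and> \<sigma> a = c then if \<bar>a\<bar> \<in> T then 1 else - 1 else 0)"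
proof -
  let ?S = "signed_interval m"
  have s: "\<sigma> \<in> B m" using represents_in_B[OF rep] by simp
  define e :: "int \<Rightarrow> int" where "e I = (if \<bar>I\<bar> \<in> T then 1 else - 1)" for I
  have block: "2 * (of_bool (lo I \<le> p \<and> q \<le> v (lo I)) + of_bool (hi I \<le> p \<and> q \<le> v (hi I))) =
    of_bool (I \<le> a \<and> c \<le> \<sigma> I) + of_bool (I \<le> b \<and> c \<le> \<sigma> I) + of_bool (I \<le> a \<and> d \<le> \<sigma> I) +
    of_bool (I \<le> b \<and> d \<le> \<sigma> I) + (if I = a \<and> b \<noteq> a \<and> d \<noteq> c \<and> \<sigma> a = c then e a else 0)"
    if "I \<in> ?S" for I
  proof -
    have "I \<noteq> 0" "\<sigma> I \<noteq> 0" using that B_mem[OF s, of I] by (auto simp: mem_signed_interval)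
    then have cuts: "lo I \<le> p \<longleftrightarrow> I \<le> a" "hi I \<le> p \<longleftrightarrow> I \<le> b" "q \<le> hi (\<sigma> I) \<longleftrightarrow> c \<le> \<sigma> I"
      "q \<le> lo (\<sigma> I) \<longleftrightarrow> d \<le> \<sigma> I"
      using a b c d by auto
    have "q \<le> v (lo I) \<longleftrightarrow> (if \<bar>I\<bar> \<in> T then c \<le> \<sigma> I else d \<le> \<sigma> I)"
      "q \<le> v (hi I) \<longleftrightarrow> (if \<bar>I\<bar> \<in> T then d \<le> \<sigma> I else c \<le> \<sigma> I)"
      using cuts by (simp_all add: represents_lo_hi[OF rep that])
    moreover have "(if I = a \<and> b \<noteq> a \<and> d \<noteq> c \<and> \<sigma> a = c then e a else 0) =
      (if I = a \<and> b \<noteq> a \<and> d \<noteq> c \<and> \<sigma> I = c then if \<bar>I\<bar> \<in> T then 1 else - 1 else 0)"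
      by (simp add: e_def)
    ultimately show ?thesis
      unfolding cuts(1,2) by (simp only: block_rank_identity[OF ab cd])
  qed
  have "2 * rk (signed_interval (2 * m)) v p q =
    (\<Sum>I\<in>?S. 2 * (of_bool (lo I \<le> p \<and> q \<le> v (lo I)) + of_bool (hi I \<le> p \<and> q \<le> v (hi I))))"
    unfolding rk_def sum_signed_interval_double sum_distrib_left ..
  also have "\<dots> = (\<Sum>I\<in>?S. of_bool (I \<le> a \<and> c \<le> \<sigma> I) + of_bool (I \<le> b \<and> c \<le> \<sigma> I) +
    of_bool (I \<le> a \<and> d \<le> \<sigma> I) + of_bool (I \<le> b \<and> d \<le> \<sigma> I) +
    (if I = a \<and> b \<noteq> a \<and> d \<noteq> c \<and> \<sigma> a = c then e a else 0))"
    by (rule sum.cong[OF refl]) (rule block)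
  also have "\<dots> = rk ?S \<sigma> a c + rk ?S \<sigma> b c + rk ?S \<sigma> a d + rk ?S \<sigma> b d +
    (\<Sum>I\<in>?S. if I = a \<and> b \<noteq> a \<and> d \<noteq> c \<and> \<sigma> a = c then e a else 0)"
    unfolding rk_def sum.distrib ..
  also have "(\<Sum>I\<in>?S. if I = a \<and> b \<noteq> a \<and> d \<noteq> c \<and> \<sigma> a = c then e a else 0) =
    (if b \<noteq> a \<and> d \<noteq> c \<and> a \<in> ?S \<and> \<sigma> a = c then e a else 0)"
    by (cases "b \<noteq> a \<and> d \<noteq> c \<and> \<sigma> a = c") auto
  finally show ?thesis unfolding e_def .
qed

text \<open>These cuts run along block boundaries, with 0 as the cut for block index 0, so no block
  is split. They recover the ranks of \<open>\<sigma>\<close> from those of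
  \<open>v\<close>.\<close>

lemma rk_represents_even:
  assumes "represents m v \<sigma> T"
  shows "rk (signed_interval (2 * m)) v (if 0 \<le> p then 2 * p else 2 * p + 1) (if 0 < q then 2 * q - 1 else 2 * q) =
    2 * rk (signed_interval m) \<sigma> p q"
proof -
  let ?p = "if 0 \<le> p then 2 * p else 2 * p + 1" and ?q = "if 0 < q then 2 * q - 1 else 2 * q"
  have "lo I \<le> ?p \<longleftrightarrow> I \<le> p" "hi I \<le> ?p \<longleftrightarrow> I \<le> p"
    "?q \<le> hi I \<longleftrightarrow> q \<le> I" "?q \<le> lo I \<longleftrightarrow> q \<le> I" if "I \<noteq> 0" for I
    using that by (auto simp: lo_def hi_def)
  then have "2 * rk (signed_interval (2 * m)) v ?p ?q = 4 * rk (signed_interval m) \<sigma> p q"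
    using rk_represents[OF assms, of ?p p p ?q q q] by simp
  then show ?thesis by simp
qed

text \<open>Here the cuts split the cell \<open>(I, J)\<close> in both directions, which is where
  \<open>T\<close> becomes visible.\<close>

lemma rk_represents_odd:
  assumes "represents m v \<sigma> T" "I \<in> signed_interval m" "J \<noteq> 0"
  shows "2 * rk (signed_interval (2 * m)) v (lo I) (hi J) =
    rk (signed_interval m) \<sigma> I J + rk (signed_interval m) \<sigma> (I - 1) J +
    rk (signed_interval m) \<sigma> I (J + 1) + rk (signed_interval m) \<sigma> (I - 1) (J + 1) +
    (if \<sigma> I = J then if \<bar>I\<bar> \<in> T then 1 else - 1 else 0)"
proof -
  have "I \<noteq> 0" using assms(2) by (rule signed_interval_ne_0)
  have "lo L \<le> lo I \<longleftrightarrow> L \<le> I" "hi L \<le> lo I \<longleftrightarrow> L \<le> I - 1"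
    "hi J \<le> hi L \<longleftrightarrow> J \<le> L" "hi J \<le> lo L \<longleftrightarrow> J + 1 \<le> L" if "L \<noteq> 0" for L
    using that \<open>I \<noteq> 0\<close> \<open>J \<noteq> 0\<close> by (auto simp: lo_def hi_def)
  then show ?thesis
    using rk_represents[OF assms(1), of "lo I" I "I - 1" "hi J" J "J + 1"] assms(2) by simp
qed

text \<open>The mixed second difference of the rank function recovers the graph.\<close>

lemma rk_dot:
  assumes "finite S" "i \<in> S"
  shows "rk S w i j - rk S w (i - 1) j - rk S w i (j + 1) + rk S w (i - 1) (j + 1) = of_bool (w i = j)"
proof -
  have "rk S w i j - rk S w (i - 1) j - rk S w i (j + 1) + rk S w (i - 1) (j + 1) =
    (\<Sum>c\<in>S. if c = i then of_bool (w i = j) else 0)"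
    unfolding rk_def sum_subtractf[symmetric] sum.distrib[symmetric]
    by (intro sum.cong refl) (auto simp: of_bool_def)
  then show ?thesis using assms by simp
qed

definition same_corners :: "nat \<Rightarrow> (int \<Rightarrow> int) \<Rightarrow> (int \<Rightarrow> int) \<Rightarrow> int \<Rightarrow> int \<Rightarrow> bool" where
  "same_corners k \<sigma> \<tau> i j \<longleftrightarrow>
    (\<forall>p q. (p = i \<or> p = i - 1) \<and> (q = j \<or> q = j + 1) \<longrightarrow>
      rk (signed_interval k) \<sigma> p q = rk (signed_interval k) \<tau> p q)"

lemma same_corners_dot:
  assumes "same_corners k \<sigma> \<tau> i j" "i \<in> signed_interval k"
  shows "\<sigma> i = j \<longleftrightarrow> \<tau> i = j"
proof -
  have "(of_bool (\<sigma> i = j) :: int) = of_bool (\<tau> i = j)"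
    unfolding rk_dot[OF finite_signed_interval assms(2), symmetric]
    using assms(1) unfolding same_corners_def by simp
  then show ?thesis by (simp add: of_bool_eq_iff)
qed

text \<open>The reflection \<open>(- p - 1, 1 - q)\<close> exchanges the corners of the cells
  \<open>(i, j)\<close> and \<open>(- i, - j)\<close>, so it suffices to state the condition on
  \<open>T\<close> at positive positions.\<close>

lemma same_corners_uminus:
  assumes "\<sigma> \<in> B k" "\<tau> \<in> B k" "same_corners k \<sigma> \<tau> i j"
  shows "same_corners k \<sigma> \<tau> (- i) (- j)"
  unfolding same_corners_def
proof (intro allI impI)
  let ?S = "signed_interval k"
  fix p q assume "(p = - i \<or> p = - i - 1) \<and> (q = - j \<or> q = - j + 1)"
  then have "rk ?S \<sigma> (- p - 1) (1 - q) = rk ?S \<tau> (- p - 1) (1 - q)"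
    using assms(3) unfolding same_corners_def by auto
  then show "rk ?S \<sigma> p q = rk ?S \<tau> p q"
    by (simp add: rk_uminus assms)
qed

text \<open>
  Inside a block the doubled rank is the sum of the ranks at its four corners, up to \<open>\<plusminus>1\<close> when
  the block contains a dot. When both permutations have a dot in the block, the corner sums
  differ by an even number, so the sign can matter only if all four corners agree.
\<close>
lemma represents_rk_le_iff:
  assumes u: "represents m u \<sigma> T" and v: "represents m v \<tau> S"
  shows "(\<forall>p q. rk (signed_interval (2 * m)) u p q \<le> rk (signed_interval (2 * m)) v p q) \<longleftrightarrow>
    (\<forall>p q. rk (signed_interval m) \<sigma> p q \<le> rk (signed_interval m) \<tau> p q) \<and>
    (\<forall>i\<in>T. same_corners m \<sigma> \<tau> i (\<sigma> i) \<longrightarrow> i \<in> S)"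
    (is "?L \<longleftrightarrow> ?R1 \<and> ?R2")
proof
  let ?S = "signed_interval m" and ?S2 = "signed_interval (2 * m)"
  note s = represents_in_B[OF u] and t = represents_in_B[OF v]
  {
    assume L: ?L
    have ?R1
    proof (intro allI)
      fix p q
      have "2 * rk ?S \<sigma> p q \<le> 2 * rk ?S \<tau> p q"
        unfolding rk_represents_even[OF u, symmetric] rk_represents_even[OF v, symmetric] using L by blast
      then show "rk ?S \<sigma> p q \<le> rk ?S \<tau> p q" by simp
    qed
    moreover have ?R2
    proof (intro ballI impI)
      fix i assume i: "i \<in> T" and same: "same_corners m \<sigma> \<tau> i (\<sigma> i)"
      have iS: "i \<in> ?S" "\<bar>i\<bar> = i" using i s(3) by (auto simp: mem_signed_interval)
      then have ne: "\<sigma> i \<noteq> 0" using B_mem[OF s(2)] signed_interval_ne_0 by blast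
      have "\<tau> i = \<sigma> i" using same_corners_dot[OF same iS(1)] by simp
      moreover have "2 * rk ?S2 u (lo i) (hi (\<sigma> i)) \<le> 2 * rk ?S2 v (lo i) (hi (\<sigma> i))" using L by simp
      ultimately show "i \<in> S"
        using same iS i unfolding rk_represents_odd[OF u iS(1) ne] rk_represents_odd[OF v iS(1) ne] same_corners_def
        by (simp split: if_splits)
    qed
    ultimately show "?R1 \<and> ?R2" ..
  }
  {
    assume R: "?R1 \<and> ?R2"
    show ?L
    proof (intro allI)
      fix p q
      obtain a b where ab: "\<And>I. I \<noteq> 0 \<Longrightarrow> lo I \<le> p \<longleftrightarrow> I \<le> a" "\<And>I. I \<noteq> 0 \<Longrightarrow> hi I \<le> p \<longleftrightarrow> I \<le> b"
        "b = a \<or> b = a - 1"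
        by (rule position_cuts[of p]) (rule that)
      obtain c d where cd: "\<And>J. J \<noteq> 0 \<Longrightarrow> q \<le> hi J \<longleftrightarrow> c \<le> J" "\<And>J. J \<noteq> 0 \<Longrightarrow> q \<le> lo J \<longleftrightarrow> d \<le> J"
        "d = c \<or> d = c + 1"
        by (rule value_cuts[of q]) (rule that)
      note ru = rk_represents[OF u ab cd] and rv = rk_represents[OF v ab cd]
      define D where "D p q = rk ?S \<tau> p q - rk ?S \<sigma> p q" for p q
      have D: "D p q \<ge> 0" for p q using R by (simp add: D_def)
      \<comment> \<open>Unless positions and values are both split, at a block \<open>a\<close> of
        the interval, no sign occurs and the four corner inequalities simply add up.\<close>
      show "rk ?S2 u p q \<le> rk ?S2 v p q"
      proof (cases "b \<noteq> a \<and> d \<noteq> c \<and> a \<in> ?S")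
        case False
        then have "2 * (rk ?S2 v p q - rk ?S2 u p q) = D a c + D b c + D a d + D b d"
          using ru rv unfolding D_def by auto
        then show ?thesis using D[of a c] D[of b c] D[of a d] D[of b d] by simp
      next
        case True
        then have b: "b = a - 1" and d: "d = c + 1" and aS: "a \<in> ?S" using ab cd by auto
        define C where "C = D a c + D b c + D a d + D b d"
        have C0: "C \<ge> 0" unfolding C_def using D[of a c] D[of b c] D[of a d] D[of b d] by linarith
        have alt: "D a c - D b c - D a d + D b d = of_bool (\<tau> a = c) - of_bool (\<sigma> a = c)"
          using rk_dot[OF finite_signed_interval aS, of \<sigma> c] rk_dot[OF finite_signed_interval aS, of \<tau> c]
          unfolding D_def b d by linarith
        have par: "even C" if "\<tau> a = c" "\<sigma> a = c"
        proof -
          have "C = 2 * (D b c + D a d)" using alt that unfolding C_def by simp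
          then show ?thesis by simp
        qed
        \<comment> \<open>If only one of the two has a dot here, the mixed difference is 1 or -1, so
          some corner is strict and absorbs the single sign.\<close>
        have pos: "C > 0" if "\<tau> a = c \<longleftrightarrow> \<sigma> a \<noteq> c"
          using alt that D[of a c] D[of b c] D[of a d] D[of b d] unfolding C_def
          by (cases "\<tau> a = c") auto
        have sgn: "\<bar>a\<bar> \<in> S" if "C = 0" "\<sigma> a = c" "\<bar>a\<bar> \<in> T"
        proof -
          have "D a c = 0" "D b c = 0" "D a d = 0" "D b d = 0"
            using that(1) D[of a c] D[of b c] D[of a d] D[of b d] unfolding C_def by linarith+
          then have same: "same_corners m \<sigma> \<tau> a (\<sigma> a)"
            unfolding same_corners_def D_def b d that(2) by auto
          have "same_corners m \<sigma> \<tau> \<bar>a\<bar> (\<sigma> \<bar>a\<bar>)"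
          proof (cases "0 < a")
            case False
            then have "\<bar>a\<bar> = - a" by simp
            then show ?thesis using same_corners_uminus[OF s(2) t(2) same] B_odd[OF s(2)] by simp
          qed (use same in simp)
          then show ?thesis using R that(3) by blast
        qed
        have "2 * (rk ?S2 v p q - rk ?S2 u p q) = C +
            (if \<tau> a = c then if \<bar>a\<bar> \<in> S then 1 else - 1 else 0) -
            (if \<sigma> a = c then if \<bar>a\<bar> \<in> T then 1 else - 1 else 0)"
          using ru rv True unfolding D_def C_def by simp
        moreover have "C \<ge> 2" if "C \<noteq> 0" "\<tau> a = c" "\<sigma> a = c"
          using par[OF that(2,3)] C0 that(1) by (elim evenE) auto
        ultimately have "2 * (rk ?S2 v p q - rk ?S2 u p q) \<ge> 0"
          using C0 pos sgn by (cases "C = 0") (auto split: if_splits)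
        then show ?thesis by simp
      qed
    qed
  }
qed

section \<open>The length in coordinates\<close>

text \<open>Two distinct blocks give four inverted pairs or none, as \<open>\<sigma>\<close> inverts
  them or not. A reversed block gives one inversion, and each element \<open>i\<close> of
  \<open>T\<close> reverses both block \<open>i\<close> and block \<open>- i\<close>.\<close>

lemma represents_invs:
  assumes "represents m v \<sigma> T"
  shows "invs (signed_interval (2 * m)) v = 4 * invs (signed_interval m) \<sigma> + 2 * int (card T)"
proof -
  let ?S = "signed_interval m"
  let ?f = "\<lambda>x y. of_bool (x < y \<and> v y < v x) :: int"
  have s: "\<sigma> \<in> B m" and T: "T \<subseteq> {1..int m}" using represents_in_B[OF assms] by auto
  have block: "?f (lo I) (lo J) + ?f (lo I) (hi J) + (?f (hi I) (lo J) + ?f (hi I) (hi J)) =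
    4 * of_bool (I < J \<and> \<sigma> J < \<sigma> I) + (if J = I then of_bool (\<bar>I\<bar> \<in> T) else 0)"
    if IJ: "I \<in> ?S" "J \<in> ?S" for I J
  proof -
    have ne: "I \<noteq> 0" "J \<noteq> 0" "\<sigma> I \<noteq> 0" "\<sigma> J \<noteq> 0"
      using IJ B_mem[OF s, of I] B_mem[OF s, of J] by (auto simp: mem_signed_interval)
    note lh = represents_lo_hi[OF assms IJ(1)] represents_lo_hi[OF assms IJ(2)]
    consider "I = J" | "I < J" | "J < I" by linarith
    then show ?thesis
    proof cases
      case 1
      then show ?thesis using lo_less_hi[of J] lo_less_hi[of "\<sigma> J"] by (auto simp: lh)
    next
      case 2
      then have pos: "hi I < lo J" using ne hi_less_lo by blast
      have "\<sigma> I \<noteq> \<sigma> J" using 2 B_inj[OF s] by simp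
      then consider "hi (\<sigma> I) < lo (\<sigma> J)" "\<sigma> I < \<sigma> J" | "hi (\<sigma> J) < lo (\<sigma> I)" "\<sigma> J < \<sigma> I"
        using hi_less_lo[OF ne(3,4)] hi_less_lo[OF ne(4,3)] by (meson linorder_neqE)
      then show ?thesis
        using 2 pos lo_less_hi[of I] lo_less_hi[of J] lo_less_hi[of "\<sigma> I"] lo_less_hi[of "\<sigma> J"]
        by cases (simp_all add: lh)
    next
      case 3
      then have "hi J < lo I" using ne hi_less_lo by blast
      then show ?thesis using 3 lo_less_hi[of I] lo_less_hi[of J] by simp
    qed
  qed
  have "invs (signed_interval (2 * m)) v =
    (\<Sum>I\<in>?S. \<Sum>J\<in>?S. ?f (lo I) (lo J) + ?f (lo I) (hi J) + (?f (hi I) (lo J) + ?f (hi I) (hi J)))"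
    unfolding invs_def sum_signed_interval_double sum.distrib[symmetric] ..
  also have "\<dots> = (\<Sum>I\<in>?S. \<Sum>J\<in>?S. 4 * of_bool (I < J \<and> \<sigma> J < \<sigma> I) + (if J = I then of_bool (\<bar>I\<bar> \<in> T) else 0))"
    by (intro sum.cong refl) (rule block)
  also have "\<dots> = 4 * invs ?S \<sigma> + (\<Sum>I\<in>?S. of_bool (\<bar>I\<bar> \<in> T))"
    unfolding invs_def sum.distrib sum_distrib_left by simp
  also have "(\<Sum>I\<in>?S. of_bool (\<bar>I\<bar> \<in> T) :: int) = (\<Sum>i\<in>{1..int m}. 2 * of_bool (i \<in> T))"
    unfolding sum_signed_interval_pos by (intro sum.cong refl) simp
  also have "\<dots> = 2 * int (card T)"
    unfolding sum_distrib_left[symmetric] using T by (simp add: Int_absorb1)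
  finally show ?thesis .
qed

text \<open>As \<open>v\<close> has twice as many negative values as \<open>\<sigma>\<close>,
  subtracting the doubled length of \<open>\<sigma>\<close> leaves \<open>4 - 1\<close> copies of
  \<open>invs\<close> and \<open>2 - 1\<close> copies of the negative count.\<close>

lemma length_W_eq:
  assumes "represents m v \<sigma> T"
  shows "2 * length_W m v = 3 * invs (signed_interval m) \<sigma> + rk (signed_interval m) \<sigma> 0 1 + 2 * int (card T)"
proof -
  note B = represents_in_B[OF assms]
  have "rk (signed_interval (2 * m)) v 0 1 = 2 * rk (signed_interval m) \<sigma> 0 1"
    using rk_represents_even[OF assms, of 0 1] by simp
  then show ?thesis
    using length_B_eq[OF B(1)] length_B_eq[OF B(2)] represents_invs[OF assms]
    by (simp add: length_W_def sigma_part_eq[OF assms])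
qed

lemma W_order_iff:
  assumes u: "represents m u \<sigma> T" and v: "represents m v \<tau> S"
  shows "(u, v) \<in> W_order (2 * m) \<longleftrightarrow>
    (\<forall>p q. rk (signed_interval m) \<sigma> p q \<le> rk (signed_interval m) \<tau> p q) \<and>
    (\<forall>i\<in>T. same_corners m \<sigma> \<tau> i (\<sigma> i) \<longrightarrow> i \<in> S)"
  unfolding represents_rk_le_iff[OF u v, symmetric]
  using represents_in_W_B[OF u] represents_in_W_B[OF v] represents_in_B[OF u] represents_in_B[OF v]
  by (simp add: W_order_def bruhat_le_iff_rk_le)

section \<open>Interpolation by elements one rank higher\<close>

lemma W_order_step:
  assumes "(u, v) \<in> W_order (2 * m)" "u \<noteq> v"
  obtains w where "(u, w) \<in> W_order (2 * m)" "(w, v) \<in> W_order (2 * m)" "length_W m w = length_W m u + 1"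
proof -
  let ?S = "signed_interval m"
  have "u \<in> W_B (2 * m)" "v \<in> W_B (2 * m)" using assms(1) by (auto simp: W_order_def)
  then obtain \<sigma> T \<tau> S where u: "represents m u \<sigma> T" and v: "represents m v \<tau> S"
    using W_B_represents by metis
  note s = represents_in_B[OF u] and t = represents_in_B[OF v]
  from assms(1) have le: "\<And>p q. rk ?S \<sigma> p q \<le> rk ?S \<tau> p q"
    and TS: "\<And>i. i \<in> T \<Longrightarrow> same_corners m \<sigma> \<tau> i (\<sigma> i) \<Longrightarrow> i \<in> S"
    unfolding W_order_iff[OF u v] by auto
  have finT: "finite T" using s(3) by (rule finite_subset) simp
  \<comment> \<open>First try to reverse one more block: this always goes up from \<open>u\<close>,
    and it stays below \<open>v\<close> precisely under the condition of the first case.\<close>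
  show ?thesis
  proof (cases "\<exists>i\<in>{1..int m} - T. same_corners m \<sigma> \<tau> i (\<sigma> i) \<longrightarrow> i \<in> S")
    case True
    then obtain i where i: "i \<in> {1..int m}" "i \<notin> T" "same_corners m \<sigma> \<tau> i (\<sigma> i) \<longrightarrow> i \<in> S" by blast
    then obtain w where w: "represents m w \<sigma> (insert i T)"
      using exists_represents[OF s(2), of "insert i T"] s(3) by blast
    show ?thesis
    proof (rule that)
      show "(u, w) \<in> W_order (2 * m)" unfolding W_order_iff[OF u w] by simp
      show "(w, v) \<in> W_order (2 * m)" unfolding W_order_iff[OF w v] using le TS i(3) by auto
      show "length_W m w = length_W m u + 1"
        using length_W_eq[OF u] length_W_eq[OF w] i(2) finT by simp
    qed
  next
    case False
    then have frozen: "same_corners m \<sigma> \<tau> i (\<sigma> i)" "i \<notin> S" if "i \<in> {1..int m}" "i \<notin> T" for i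
      using that by auto
    \<comment> \<open>If \<open>\<sigma> = \<tau>\<close>, all corners agree; then the order gives
      \<open>T \<subseteq> S\<close> and freezing gives \<open>S \<subseteq> T\<close>, so
      \<open>u = v\<close>.\<close>
    have "\<sigma> \<noteq> \<tau>"
    proof
      assume st: "\<sigma> = \<tau>"
      have "T \<subseteq> S" using TS st by (auto simp: same_corners_def)
      moreover have "S \<subseteq> T" using frozen(2) t(3) by blast
      ultimately show False using represents_fun_unique[of m u \<sigma> T v] u v st assms(2) by simp
    qed
    from s(2) t(2) this le
    obtain r where r: "\<sigma> \<circ> r \<in> B m" "\<And>p q. rk ?S \<sigma> p q \<le> rk ?S (\<sigma> \<circ> r) p q"
      "\<And>p q. rk ?S (\<sigma> \<circ> r) p q \<le> rk ?S \<tau> p q"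
      "3 * (invs ?S (\<sigma> \<circ> r) - invs ?S \<sigma>) + (rk ?S (\<sigma> \<circ> r) 0 1 - rk ?S \<sigma> 0 1) =
        2 * int (card {c \<in> {1..int m}. r c \<noteq> c}) + 2"
      "\<And>c p q. c \<in> ?S \<Longrightarrow> r c = c \<Longrightarrow> p = c \<or> p = c - 1 \<Longrightarrow> q = \<sigma> c \<or> q = \<sigma> c + 1 \<Longrightarrow>
        rk ?S (\<sigma> \<circ> r) p q = rk ?S \<sigma> p q"
      by (rule exists_bruhat_cover_below) (rule that)
    define M where "M = {c \<in> {1..int m}. r c \<noteq> c}"
    have mem: "i \<in> ?S" if "i \<in> {1..int m}" for i using that by (simp add: mem_signed_interval)
    have fix_iff: "r i = i \<longleftrightarrow> (\<sigma> \<circ> r) i = \<sigma> i" for i using B_inj[OF s(2)] by simp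
    \<comment> \<open>At a frozen \<open>i\<close> the corner ranks of
      \<open>\<sigma> \<circ> r\<close> are squeezed between the equal ones of
      \<open>\<sigma>\<close> and \<open>\<tau>\<close>, so the dot at \<open>i\<close> cannot
      move.\<close>
    have moved: "M \<subseteq> T"
    proof (rule ccontr)
      assume "\<not> M \<subseteq> T"
      then obtain i where i: "i \<in> {1..int m}" "r i \<noteq> i" "i \<notin> T" by (auto simp: M_def)
      have "same_corners m \<sigma> (\<sigma> \<circ> r) i (\<sigma> i)"
        using frozen(1)[OF i(1,3)] r(2,3) unfolding same_corners_def by (metis order_antisym)
      then show False using same_corners_dot[OF _ mem[OF i(1)]] fix_iff i(2) by blast
    qed
    \<comment> \<open>At a moved position the corners of \<open>\<sigma>\<close> and
      \<open>\<sigma> \<circ> r\<close> cannot all agree, so deleting it from \<open>T\<close> still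
      leaves an element above \<open>u\<close>.\<close>
    obtain w where w: "represents m w (\<sigma> \<circ> r) (T - M)"
      using exists_represents[OF r(1), of "T - M"] s(3) by blast
    show ?thesis
    proof (rule that)
      show "(u, w) \<in> W_order (2 * m)" unfolding W_order_iff[OF u w]
      proof (intro conjI allI ballI impI r(2))
        fix i assume i: "i \<in> T" "same_corners m \<sigma> (\<sigma> \<circ> r) i (\<sigma> i)"
        then have "r i = i" using same_corners_dot[OF i(2) mem] fix_iff s(3) by blast
        then show "i \<in> T - M" using i(1) by (simp add: M_def)
      qed
      show "(w, v) \<in> W_order (2 * m)" unfolding W_order_iff[OF w v]
      proof (intro conjI allI ballI impI r(3))
        fix i assume i: "i \<in> T - M" "same_corners m (\<sigma> \<circ> r) \<tau> i ((\<sigma> \<circ> r) i)"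
        then have ri: "r i = i" "i \<in> {1..int m}" using s(3) by (auto simp: M_def)
        have "same_corners m \<sigma> \<tau> i (\<sigma> i)"
          using i(2) r(5)[OF mem[OF ri(2)] ri(1)] ri(1) unfolding same_corners_def by simp
        then show "i \<in> S" using TS i(1) by blast
      qed
      \<comment> \<open>In doubled length the cover gains \<open>2 * card M + 2\<close> and the
        deletion costs \<open>2 * card M\<close>.\<close>
      have "card (T - M) + card M = card T"
        using moved finT by (metis (no_types, lifting) card_Diff_subset card_mono finite_subset le_add_diff_inverse2)
      then have "int (card (T - M)) + int (card M) = int (card T)" by linarith
      then show "length_W m w = length_W m u + 1"
        using length_W_eq[OF u] length_W_eq[OF w] r(4)[folded M_def] by simp
    qed
  qed
qed

section \<open>Least and greatest elements\<close>

text \<open>Of the positions up to \<open>p\<close>, at most as many take a value below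
  \<open>q\<close> as there are such values. This gives a lower bound for every rank, which the
  identity attains if \<open>q \<le> p + 1\<close>; otherwise its rank is 0.\<close>

lemma rk_id_le:
  assumes "w permutes S" "finite S"
  shows "rk S id p q \<le> rk S w p q"
proof -
  have perm: "(\<Sum>c\<in>S. of_bool (w c < q) :: int) = (\<Sum>c\<in>S. of_bool (c < q))"
    using sum.permute[OF assms(1), of "\<lambda>c. of_bool (c < q) :: int"] by (simp add: o_def)
  show ?thesis
  proof (cases "q \<le> p + 1")
    case True
    have "rk S id p q = (\<Sum>c\<in>S. of_bool (c \<le> p) - of_bool (c < q))"
      unfolding rk_def by (intro sum.cong refl) (use True in \<open>auto simp: of_bool_def\<close>)
    also have "\<dots> = (\<Sum>c\<in>S. of_bool (c \<le> p) - of_bool (w c < q))"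
      by (simp only: sum_subtractf perm)
    also have "\<dots> \<le> rk S w p q"
      unfolding rk_def by (intro sum_mono) (auto simp: of_bool_def)
    finally show ?thesis .
  next
    case False
    then have "rk S id p q = 0" unfolding rk_def by (intro sum.neutral) auto
    also have "0 \<le> rk S w p q" unfolding rk_def by (intro sum_nonneg) simp
    finally show ?thesis .
  qed
qed

text \<open>The longest element of \<open>B k\<close>, greatest in the Bruhat order.\<close>

definition longest_B :: "nat \<Rightarrow> int \<Rightarrow> int" where
  "longest_B k x = (if x \<in> signed_interval k then - x else x)"

lemma longest_B_in_B: "longest_B k \<in> B k"
proof (rule B_I)
  have "bij_betw (longest_B k) (signed_interval k) (signed_interval k)"
    by (rule bij_betw_byWitness[of _ uminus]) (auto simp: longest_B_def)
  then show "longest_B k permutes signed_interval k" by (rule bij_imp_permutes) (simp add: longest_B_def)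
qed (simp add: longest_B_def)

text \<open>A rank is bounded by the number of positions up to \<open>p\<close> and by the number of
  values from \<open>q\<close> on. For negation one of the two conditions implies the other, so one
  bound is attained.\<close>

lemma rk_longest_B_ge:
  assumes "w \<in> B k"
  shows "rk (signed_interval k) w p q \<le> rk (signed_interval k) (longest_B k) p q"
proof (cases "p \<le> - q")
  let ?S = "signed_interval k"
  case True
  have "rk ?S w p q \<le> (\<Sum>c\<in>?S. of_bool (c \<le> p))"
    unfolding rk_def by (intro sum_mono) simp
  also have "\<dots> = rk ?S (longest_B k) p q"
    unfolding rk_def by (intro sum.cong refl) (use True in \<open>auto simp: longest_B_def\<close>)
  finally show ?thesis .
next
  let ?S = "signed_interval k"
  case False
  have "rk ?S w p q \<le> (\<Sum>c\<in>?S. of_bool (q \<le> w c))"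
    unfolding rk_def by (intro sum_mono) simp
  also have "\<dots> = (\<Sum>c\<in>?S. of_bool (q \<le> - c))"
    using sum.permute[OF B_permutes[OF assms], of "\<lambda>c. of_bool (q \<le> c) :: int"]
      sum_signed_interval_uminus[of "\<lambda>c. of_bool (q \<le> c) :: int" k] by (simp add: o_def)
  also have "\<dots> = rk ?S (longest_B k) p q"
    unfolding rk_def by (intro sum.cong refl) (use False in \<open>auto simp: longest_B_def\<close>)
  finally show ?thesis .
qed

text \<open>Every pair of the \<open>2 * k\<close> positions is inverted. The pairs are counted by
  adding the mirror image of the sum in its two indices.\<close>

lemma invs_longest_B: "invs (signed_interval k) (longest_B k) = 2 * int k * int k - int k"
proof -
  let ?S = "signed_interval k"
  have "(\<Sum>c\<in>?S. 1 :: nat) = 2 * k" unfolding sum_signed_interval_pos by simp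
  then have card: "card ?S = 2 * k" by simp
  have I: "invs ?S (longest_B k) = (\<Sum>a\<in>?S. \<Sum>b\<in>?S. of_bool (a < b))"
    unfolding invs_def by (intro sum.cong refl) (auto simp: longest_B_def)
  then have I': "invs ?S (longest_B k) = (\<Sum>a\<in>?S. \<Sum>b\<in>?S. of_bool (b < a))"
    by (subst sum.swap) simp
  have "2 * invs ?S (longest_B k) = (\<Sum>a\<in>?S. \<Sum>b\<in>?S. of_bool (a < b) + of_bool (b < a))"
    unfolding sum.distrib I[symmetric] I'[symmetric] by simp
  also have "\<dots> = (\<Sum>a\<in>?S. \<Sum>b\<in>?S. 1 - (if b = a then 1 else 0))"
    by (intro sum.cong refl) (auto simp: of_bool_def)
  also have "\<dots> = (\<Sum>a\<in>?S. 2 * int k - 1)"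
    unfolding sum_subtractf by (simp add: card)
  also have "\<dots> = 2 * (2 * int k * int k - int k)" by (simp add: card algebra_simps)
  finally show ?thesis by simp
qed

lemma W_order_bot:
  obtains b where "b \<in> W_B (2 * m)" "\<And>v. v \<in> W_B (2 * m) \<Longrightarrow> (b, v) \<in> W_order (2 * m)" "length_W m b = 0"
proof -
  have "id \<in> B m" by (rule B_I) (simp_all add: permutes_id)
  then obtain b where b: "represents m b id {}" using exists_represents by (metis empty_subsetI)
  show ?thesis
  proof (rule that)
    show "b \<in> W_B (2 * m)" using b by (rule represents_in_W_B)
    fix v assume "v \<in> W_B (2 * m)"
    then obtain \<tau> S where v: "represents m v \<tau> S" using W_B_represents by metis
    show "(b, v) \<in> W_order (2 * m)" unfolding W_order_iff[OF b v]
      using rk_id_le B_permutes represents_in_B[OF v] by simp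
  next
    have "invs (signed_interval m) id = 0" unfolding invs_def by (intro sum.neutral ballI) auto
    moreover have "rk (signed_interval m) id 0 1 = 0" unfolding rk_def by (intro sum.neutral ballI) auto
    ultimately show "length_W m b = 0" using length_W_eq[OF b] by simp
  qed
qed

text \<open>The maximum reverses everything. Its doubled rank is
  \<open>3 * (2 * m * m - m) + m + 2 * m = 6 * m * m\<close>, the last two terms coming from the
  negative values and from \<open>T\<close>.\<close>

lemma W_order_top:
  obtains t where "t \<in> W_B (2 * m)" "\<And>v. v \<in> W_B (2 * m) \<Longrightarrow> (v, t) \<in> W_order (2 * m)" "length_W m t = 3 * int m ^ 2"
proof -
  obtain t where t: "represents m t (longest_B m) {1..int m}"
    using exists_represents[OF longest_B_in_B] by blast
  show ?thesis
  proof (rule that)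
    show "t \<in> W_B (2 * m)" using t by (rule represents_in_W_B)
    fix v assume "v \<in> W_B (2 * m)"
    then obtain \<tau> S where v: "represents m v \<tau> S" using W_B_represents by metis
    show "(v, t) \<in> W_order (2 * m)" unfolding W_order_iff[OF v t]
      using rk_longest_B_ge represents_in_B[OF v] by blast
  next
    have "rk (signed_interval m) (longest_B m) 0 1 = (\<Sum>c\<in>{1..int m}. 1)"
      unfolding rk_def sum_signed_interval_pos
      by (intro sum.cong refl) (auto simp: longest_B_def mem_signed_interval)
    then show "length_W m t = 3 * int m ^ 2"
      using length_W_eq[OF t] invs_longest_B[of m] by (simp add: power2_eq_square)
  qed
qed

section \<open>Partial order and strict monotonicity of the rank\<close>

lemma partial_order_W_order: "partial_order_on (W_B n) (W_order n)"
proof -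
  have "antisym (W_order n)"
  proof (rule antisymI, rule ccontr)
    fix u v assume "(u, v) \<in> W_order n" "(v, u) \<in> W_order n" "u \<noteq> v"
    then have "length_B n u < length_B n v" "length_B n v < length_B n u"
      using bruhat_le_length_less by (auto simp: W_order_def)
    then show False by simp
  qed
  moreover have "trans (W_order n)"
    by (rule transI) (auto simp: W_order_def bruhat_le_def)
  ultimately show ?thesis
    by (auto simp: partial_order_on_def preorder_on_def refl_on_def W_order_def bruhat_le_def)
qed

text \<open>Iterates \<open>W_order_step\<close>. The gap in \<open>length_B\<close>, already known
  to be strictly monotone, bounds the number of iterations.\<close>

lemma length_W_less:
  assumes "(u, v) \<in> W_order (2 * m)" "u \<noteq> v"
  shows "length_W m u < length_W m v"
  using assms
proof (induction "length_B (2 * m) v - length_B (2 * m) u" arbitrary: u rule: less_induct)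
  case less
  obtain w where w: "(u, w) \<in> W_order (2 * m)" "(w, v) \<in> W_order (2 * m)" "length_W m w = length_W m u + 1"
    using W_order_step[OF less.prems] .
  show ?case
  proof (cases "w = v")
    case False
    have "u \<noteq> w" using w(3) by auto
    then have "length_B (2 * m) u < length_B (2 * m) w" "length_B (2 * m) w < length_B (2 * m) v"
      using w False bruhat_le_length_less by (auto simp: W_order_def)
    then have "length_W m w < length_W m v" using less.hyps[of w] w False by simp
    then show ?thesis using w(3) by simp
  qed (use w(3) in simp)
qed

section \<open>Maximal chains and gradedness\<close>

text \<open>Strictness makes \<open>\<rho>\<close> injective on a maximal chain. If it missed a
  value, interpolating across the gap would give an element comparable with the whole chain, hence
  in it by maximality, yet with its rank in the gap. So the chain is in bijection with
  \<open>{0..int n}\<close>.\<close>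

lemma graded_posetI:
  fixes r :: "('a \<times> 'a) set" and \<rho> :: "'a \<Rightarrow> int"
  assumes po: "partial_order_on A r" and rA: "r \<subseteq> A \<times> A"
    and bot: "b \<in> A" "\<And>x. x \<in> A \<Longrightarrow> (b, x) \<in> r" "\<rho> b = 0"
    and top: "t \<in> A" "\<And>x. x \<in> A \<Longrightarrow> (x, t) \<in> r" "\<rho> t = int n"
    and strict: "\<And>x y. (x, y) \<in> r \<Longrightarrow> x \<noteq> y \<Longrightarrow> \<rho> x < \<rho> y"
    and step: "\<And>x y. (x, y) \<in> r \<Longrightarrow> x \<noteq> y \<Longrightarrow> \<exists>z. (x, z) \<in> r \<and> (z, y) \<in> r \<and> \<rho> z = \<rho> x + 1"
  shows "graded_poset_of_rank A r n \<and> rank_function A r \<rho>"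
proof
  have refl: "(x, x) \<in> r" if "x \<in> A" for x
    using po that by (auto simp: partial_order_on_def preorder_on_def refl_on_def)
  have trans: "(x, z) \<in> r" if "(x, y) \<in> r" "(y, z) \<in> r" for x y z
    using po that by (auto simp: partial_order_on_def preorder_on_def dest: transD)
  have antisym: "x = y" if "(x, y) \<in> r" "(y, x) \<in> r" for x y
    using po that by (auto simp: partial_order_on_def dest: antisymD)
  show "rank_function A r \<rho>" unfolding rank_function_def
  proof (intro conjI allI impI)
    fix x assume "minimal_in A r x"
    then have "x = b" using bot unfolding minimal_in_def by blast
    then show "\<rho> x = 0" using bot by simp
  next
    fix x y assume xy: "covered_by A r x y"
    then obtain z where z: "(x, z) \<in> r" "(z, y) \<in> r" "\<rho> z = \<rho> x + 1"
      using step unfolding covered_by_def by blast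
    then have "z = x \<or> z = y" using xy rA unfolding covered_by_def by blast
    then show "\<rho> y = \<rho> x + 1" using z(3) by auto
  qed
  have "card C = n + 1" if C: "pred_on.maxchain A (\<lambda>x y. (x, y) \<in> r) C" for C
  proof -
    have CA: "C \<subseteq> A" and comp: "\<And>x y. x \<in> C \<Longrightarrow> y \<in> C \<Longrightarrow> (x, y) \<in> r \<or> (y, x) \<in> r"
      using C refl unfolding pred_on.maxchain_def pred_on.chain_def by blast+
    have max: "x \<in> C" if x: "x \<in> A" "\<And>y. y \<in> C \<Longrightarrow> (x, y) \<in> r \<or> (y, x) \<in> r" for x
    proof (rule ccontr)
      assume "x \<notin> C"
      moreover have "pred_on.chain A (\<lambda>x y. (x, y) \<in> r) (insert x C)"
        using x CA comp unfolding pred_on.chain_def by blast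
      ultimately show False using C unfolding pred_on.maxchain_def by blast
    qed
    have mono: "(x, y) \<in> r" if "x \<in> C" "y \<in> C" "\<rho> x < \<rho> y" for x y
      using comp[OF that(1,2)] strict[of y x] that(3) by fastforce
    have inj: "inj_on \<rho> C"
    proof
      fix x y assume "x \<in> C" "y \<in> C" "\<rho> x = \<rho> y"
      then show "x = y" using comp[of x y] strict[of x y] strict[of y x] by fastforce
    qed
    have bC: "b \<in> C" and tC: "t \<in> C" using max bot top CA by blast+
    have "\<rho> ` C = {0..int n}"
    proof
      show "\<rho> ` C \<subseteq> {0..int n}"
      proof
        fix k assume "k \<in> \<rho> ` C"
        then obtain x where x: "x \<in> A" "k = \<rho> x" using CA by blast
        then show "k \<in> {0..int n}"
          using bot(2)[of x] bot(3) top(2)[of x] top(3) strict[of b x] strict[of x t] by fastforce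
      qed
      show "{0..int n} \<subseteq> \<rho> ` C"
      proof (rule ccontr)
        assume "\<not> {0..int n} \<subseteq> \<rho> ` C"
        then obtain k where "k \<in> {0..int n}" and "k \<notin> \<rho> ` C" by blast
        then have k: "0 \<le> k" "k \<le> int n" "k \<notin> \<rho> ` C" by simp_all
        have fin: "finite C" using inj \<open>\<rho> ` C \<subseteq> {0..int n}\<close> by (meson finite_atLeastAtMost_int finite_imageD finite_subset)
        let ?L = "{x \<in> C. \<rho> x < k}" and ?U = "{x \<in> C. k < \<rho> x}"
        have "\<rho> b \<noteq> k" "\<rho> t \<noteq> k" using bC tC k(3) by blast+
        then have "b \<in> ?L" "t \<in> ?U" using bC bot(3) tC top(3) k by auto
        \<comment> \<open>\<open>x\<close> and \<open>y\<close> are the chain elements bordering the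
          gap at \<open>k\<close>; \<open>\<rho>\<close> is maximised by minimising its
          negative.\<close>
        obtain x where x: "x \<in> ?L" "\<And>y. y \<in> ?L \<Longrightarrow> \<rho> y \<le> \<rho> x"
          using fin \<open>b \<in> ?L\<close> arg_min_if_finite(1)[of ?L "\<lambda>x. - \<rho> x"] arg_min_least[of ?L _ "\<lambda>x. - \<rho> x"]
          by (intro that[of "arg_min_on (\<lambda>x. - \<rho> x) ?L"]) auto
        obtain y where y: "y \<in> ?U" "\<And>z. z \<in> ?U \<Longrightarrow> \<rho> y \<le> \<rho> z"
          using fin \<open>t \<in> ?U\<close> arg_min_if_finite(1)[of ?U \<rho>] arg_min_least[of ?U _ \<rho>]
          by (intro that[of "arg_min_on \<rho> ?U"]) auto
        have "(x, y) \<in> r" "x \<noteq> y" using mono x y by auto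
        then obtain z where z: "(x, z) \<in> r" "(z, y) \<in> r" "\<rho> z = \<rho> x + 1" using step by blast
        \<comment> \<open>Every chain element lies below \<open>x\<close> or above \<open>y\<close>,
          hence is comparable with \<open>z\<close>.\<close>
        have "z \<in> C"
        proof (rule max)
          show "z \<in> A" using z(1) rA by blast
          fix c assume c: "c \<in> C"
          then have "\<rho> c \<noteq> k" using k by blast
          then consider "c \<in> ?L" | "c \<in> ?U" using c by fastforce
          then show "(z, c) \<in> r \<or> (c, z) \<in> r"
          proof cases
            case 1
            then have "(c, x) \<in> r" using x comp[of c x] strict[of x c] by fastforce
            then show ?thesis using z trans by blast
          next
            case 2
            then have "(y, c) \<in> r" using y comp[of c y] strict[of c y] by fastforce
            then show ?thesis using z trans by blast
          qed
        qed
        \<comment> \<open>\<open>\<rho> z\<close> exceeds the largest chain value below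
          \<open>k\<close>, so it would have to be the missing value itself.\<close>
        moreover have "\<rho> z \<le> k" using z(3) x(1) by simp
        moreover have "\<rho> z \<noteq> k" using \<open>z \<in> C\<close> k(3) by blast
        ultimately show False using x(2)[of z] z(3) by simp
      qed
    qed
    then have "card C = card {0..int n}" using card_image[OF inj] by simp
    then show ?thesis by simp
  qed
  then show "graded_poset_of_rank A r n" using po unfolding graded_poset_of_rank_def by blast
qed

theorem theorem4p7:
  fixes m :: nat
  assumes "m \<ge> 1"
  shows "graded_poset_of_rank (W_B (2 * m)) (W_order (2 * m)) (3 * m\<^sup>2) \<and>
         rank_function (W_B (2 * m)) (W_order (2 * m)) (length_W m)"
proof -
  obtain b where b: "b \<in> W_B (2 * m)" "\<And>v. v \<in> W_B (2 * m) \<Longrightarrow> (b, v) \<in> W_order (2 * m)" "length_W m b = 0"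
    by (rule W_order_bot) (rule that)
  obtain t where t: "t \<in> W_B (2 * m)" "\<And>v. v \<in> W_B (2 * m) \<Longrightarrow> (v, t) \<in> W_order (2 * m)"
    "length_W m t = 3 * int m ^ 2"
    by (rule W_order_top) (rule that)
  have "\<exists>w. (u, w) \<in> W_order (2 * m) \<and> (w, v) \<in> W_order (2 * m) \<and> length_W m w = length_W m u + 1"
    if "(u, v) \<in> W_order (2 * m)" "u \<noteq> v" for u v
    using W_order_step[OF that] by blast
  then show ?thesis
    using b t length_W_less partial_order_W_order
    by (intro graded_posetI[of _ _ b _ t]) (auto simp: W_order_def)
qed

end
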